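(* The problem $\mathrm{SRD}^\rho$ admits an online algorithm which is $4.2574$-competitive (for every $\rho>\sqrt2$) and $0$-effective.
   Context: Symmetric Rendezvous in a Disk, normalization $\mathrm{SRD}^\rho$ ($\rho>\sqrt2$): two robots start at two points of a circle of radius $\rho$ centred at a reference point $O$, at Euclidean distance $2$ from each other. Both robots know $O$, $\rho$ and their initial distance, but neither knows which of the two points of the circle at distance $2$ from it is its peer's position. Robots move in the plane with speed at most $1$, run the same synchronized randomized algorithm with independent random bits, and detect each other only when they occupy the same point at the same time (rendezvous). The optimal offline rendezvous time is $1$, so the competitive ratio of an algorithm on $\mathrm{SRD}^\rho$ is its expected rendezvous time; an algorithm is $c$-competitive if its competitive ratio is $c$. A family of algorithms (one for each $\rho$) is $\delta$-effective if $\delta$ is the largest value of $\rho$ for which its expected rendezvous time in $\mathrm{SRD}^\rho$ is at most $4.25$; it is $0$-effective if its expected rendezvous time is at least $4.25$ for all $\rho>\sqrt2$. *)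

theory Defs
  imports "HOL-Probability.Probability"
begin

text \<open>The plane is \<^typ>\<open>complex\<close>, with the reference point \<open>O\<close> at the origin.\<close>

type_synonym trajectory = "real \<Rightarrow> complex"
type_synonym algorithm = "(nat \<Rightarrow> bool) \<Rightarrow> trajectory"

definition coin_flips :: "(nat \<Rightarrow> bool) measure" where
  "coin_flips = (\<Pi>\<^sub>M i\<in>UNIV. measure_pmf (bernoulli_pmf (1/2)))"

text \<open>
  An algorithm turns a sequence of random bits into a trajectory in the robot's own frame of
  reference, in which \<open>O\<close> is the origin and the robot starts at the point \<open>\<rho>\<close> of the real axis.
  Nothing can be observed before the rendezvous, so the bits and the elapsed time are the only
  information a trajectory can depend on. In particular it cannot depend on the position of the
  robot on the circle, nor on the side on which the peer is.
\<close>

definition SRD_algorithm :: "real \<Rightarrow> algorithm \<Rightarrow> bool" where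
  "SRD_algorithm \<rho> X \<longleftrightarrow>
     (\<forall>\<omega>. X \<omega> 0 = of_real \<rho> \<and> 1-lipschitz_on {0..} (X \<omega>)) \<and>
     (\<forall>t\<ge>0. (\<lambda>\<omega>. X \<omega> t) \<in> borel_measurable coin_flips)"

text \<open>
  An instance places the frames of the two robots by isometries \<open>U\<close> and \<open>V\<close> of the plane fixing
  \<open>O\<close>. As \<open>\<rho>\<close> and \<open>O\<close> determine a frame only up to reflection, each isometry is a rotation or a
  reflection: the robots share neither a compass nor a sense of orientation.
\<close>

definition SRD_instances :: "real \<Rightarrow> ((complex \<Rightarrow> complex) \<times> (complex \<Rightarrow> complex)) set" where
  "SRD_instances \<rho> =
     {(U, V). orthogonal_transformation U \<and> orthogonal_transformation V \<and>
              dist (U (of_real \<rho>)) (V (of_real \<rho>)) = 2}"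

text \<open>The infimum of the empty set is \<open>\<infinity>\<close>, the value when the robots never meet.\<close>

definition rendezvous_time :: "trajectory \<Rightarrow> trajectory \<Rightarrow> ennreal" where
  "rendezvous_time p q = (INF t\<in>{t. 0 \<le> t \<and> p t = q t}. ennreal t)"

definition expected_rendezvous_time ::
    "algorithm \<Rightarrow> (complex \<Rightarrow> complex) \<times> (complex \<Rightarrow> complex) \<Rightarrow> ennreal" where
  "expected_rendezvous_time X = (\<lambda>(U, V).
     \<integral>\<^sup>+ (\<omega>, \<omega>'). rendezvous_time (\<lambda>t. U (X \<omega> t)) (\<lambda>t. V (X \<omega>' t))
       \<partial>(coin_flips \<Otimes>\<^sub>M coin_flips))"

text \<open>
  Robots that see each other meet at time 1, halfway between their starting points, and no two
  robots meet earlier. Hence the offline optimum by which the expected time is divided is 1.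
\<close>

definition competitive_ratio :: "real \<Rightarrow> algorithm \<Rightarrow> ennreal" where
  "competitive_ratio \<rho> X = (SUP I\<in>SRD_instances \<rho>. expected_rendezvous_time X I)"

definition competitive :: "real \<Rightarrow> real \<Rightarrow> algorithm \<Rightarrow> bool" where
  "competitive c \<rho> X \<longleftrightarrow> competitive_ratio \<rho> X = ennreal c"

definition effective :: "real \<Rightarrow> (real \<Rightarrow> algorithm) \<Rightarrow> bool" where
  "effective \<delta> A \<longleftrightarrow>
     (if \<delta> = 0 then \<forall>\<rho>>sqrt 2. competitive_ratio \<rho> (A \<rho>) \<ge> ennreal 4.25
      else \<delta> > sqrt 2 \<and> competitive_ratio \<delta> (A \<delta>) \<le> ennreal 4.25 \<and>
           (\<forall>\<rho>>sqrt 2. competitive_ratio \<rho> (A \<rho>) \<le> ennreal 4.25 \<longrightarrow> \<rho> \<le> \<delta>))"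

end

theory Submission
  imports Defs
begin

text \<open>
  The chords of length 2 starting at a robot's position form an infinite chain inscribed in the
  circle. Walking along this chain, both robots play the symmetric rendezvous game on the line with
  initial distance 2, whatever \<open>\<rho>\<close> is. There they use independent phases of 21 unit steps: a random
  direction, one step in it, and then a random word of 20 steps that leads to the opposite
  neighbour of the point where the phase began. If the first steps are opposite, then the robots
  meet during the phase; otherwise they meet or are again at distance 2 at its end. So the expected
  time \<open>T\<close> satisfies \<open>T = C + p T\<close>, where \<open>p\<close> is the probability that a phase fails, and a suitable
  distribution of the words gives \<open>T < 4.2574\<close>. Waiting before the start adds a constant to every
  rendezvous time, which turns the bound into an equality.
\<close>

subsection \<open>Lower integrals of possibly non-measurable functions\<close>

text \<open>Every phase moves a robot by minus its first step. Equal first steps therefore keep the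
  signed gap, and outward ones widen it to 4, which the two returns close exactly. Only an upper
  bound on the rendezvous time of the walk is needed: if the chain overlaps itself, accidental
  meetings can only help, and the final delay absorbs the slack. Since the delayed algorithm attains
  4.2574 exactly, being 0-effective reduces to 4.25 \<le> 4.2574.

  Two obstacles shape the argument. \<open>T\<close> could a priori be infinite, so the equation for
  it cannot simply be solved; instead the bound is proved by induction for truncations to
  \<open>N\<close> phases and passed to the limit. The rendezvous time is not shown to be
  measurable, so it is handled only by monotonicity and by adding constants, both valid for lower
  integrals.

  The table gives \<open>C = 71315950 / 2^24\<close> and \<open>p = 25924 / 2^24\<close>, hence
  \<open>C / (1 - p)\<close> is about 4.25734.\<close>

lemma nn_integral_const_add:
  assumes "prob_space M" "c < top"
  shows "(\<integral>\<^sup>+x. c + f x \<partial>M) = c + (\<integral>\<^sup>+x. f x \<partial>M)"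
proof (rule antisym)
  interpret prob_space M by fact
  show "(\<integral>\<^sup>+x. c + f x \<partial>M) \<le> c + (\<integral>\<^sup>+x. f x \<partial>M)"
    unfolding nn_integral_def[of M "\<lambda>x. c + f x"]
  proof (safe intro!: SUP_least)
    fix g assume g: "simple_function M g" "g \<le> (\<lambda>x. c + f x)"
    have [measurable]: "g \<in> borel_measurable M"
      using g(1) by (rule borel_measurable_simple_function)
    have "integral\<^sup>S M g = (\<integral>\<^sup>+x. g x \<partial>M)"
      using g(1) by (simp add: nn_integral_eq_simple_integral)
    \<comment> \<open>Truncated subtraction satisfies \<open>g x \<le> c + (g x - c)\<close>; the
      difference is measurable and lies below \<open>f\<close>, so no measurability of
      \<open>f\<close> is needed.\<close>
    also have "\<dots> \<le> (\<integral>\<^sup>+x. c + (g x - c) \<partial>M)"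
      by (intro nn_integral_mono) (auto simp: add_diff_self_ennreal)
    also have "\<dots> = c + (\<integral>\<^sup>+x. g x - c \<partial>M)"
      by (subst nn_integral_add) (auto simp: emeasure_space_1)
    also have "\<dots> \<le> c + (\<integral>\<^sup>+x. f x \<partial>M)"
      using g(2) assms(2) by (intro add_left_mono nn_integral_mono) (auto simp: le_fun_def ennreal_minus_le_iff)
    finally show "integral\<^sup>S M g \<le> c + (\<integral>\<^sup>+x. f x \<partial>M)" .
  qed
  have "c + (\<integral>\<^sup>+x. f x \<partial>M) = (SUP g\<in>{g. simple_function M g \<and> g \<le> f}. c + integral\<^sup>S M g)"
    unfolding nn_integral_def[of M f]
    by (subst ennreal_SUP_add_right) (auto intro!: exI[of _ "\<lambda>_. 0"] simp: le_fun_def)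
  also have "\<dots> \<le> (\<integral>\<^sup>+x. c + f x \<partial>M)"
  proof (safe intro!: SUP_least)
    fix g assume g: "simple_function M g" "g \<le> f"
    have [measurable]: "g \<in> borel_measurable M"
      using g(1) by (rule borel_measurable_simple_function)
    have "c + integral\<^sup>S M g = (\<integral>\<^sup>+x. c + g x \<partial>M)"
      using g(1) by (subst nn_integral_add) (auto simp: emeasure_space_1 nn_integral_eq_simple_integral)
    also have "\<dots> \<le> (\<integral>\<^sup>+x. c + f x \<partial>M)"
      using g(2) by (intro nn_integral_mono) (auto simp: le_fun_def)
    finally show "c + integral\<^sup>S M g \<le> (\<integral>\<^sup>+x. c + f x \<partial>M)" .
  qed
  finally show "c + (\<integral>\<^sup>+x. f x \<partial>M) \<le> (\<integral>\<^sup>+x. c + f x \<partial>M)" .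
qed

subsection \<open>Blocks of coin flips\<close>

interpretation coin_flips: sequence_space "measure_pmf (bernoulli_pmf (1/2))"
  by unfold_locales

interpretation coin_pair: pair_prob_space coin_flips coin_flips
  unfolding coin_flips_def by unfold_locales

definition skip :: "nat \<Rightarrow> (nat \<Rightarrow> bool) \<Rightarrow> nat \<Rightarrow> bool" where
  "skip b \<omega> = (\<lambda>i. \<omega> (b + i))"

fun number :: "nat \<Rightarrow> (nat \<Rightarrow> bool) \<Rightarrow> nat" where
  "number 0 \<omega> = 0"
| "number (Suc b) \<omega> = of_bool (\<omega> 0) + 2 * number b (skip 1 \<omega>)"

lemma skip_skip: "skip a (skip b \<omega>) = skip (b + a) \<omega>"
  by (simp add: skip_def add.assoc)

lemma number_less: "number b \<omega> < 2 ^ b"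
proof (induction b arbitrary: \<omega>)
  case (Suc b)
  from Suc[of "skip 1 \<omega>"] show ?case by simp
qed simp

lemma measurable_coin [measurable]: "(\<lambda>\<omega>. \<omega> i) \<in> measurable coin_flips (count_space UNIV)"
proof -
  have "(\<lambda>\<omega>. \<omega> i) \<in> measurable coin_flips (measure_pmf (bernoulli_pmf (1/2)))"
    unfolding coin_flips_def by (rule measurable_component_singleton) simp
  then show ?thesis by (simp add: measurable_def)
qed

lemma measurable_skip [measurable]: "skip b \<in> measurable coin_flips coin_flips"
proof -
  have "(\<lambda>\<omega>. skip b \<omega> i) \<in> measurable coin_flips (measure_pmf (bernoulli_pmf (1/2)))" for i
    unfolding skip_def using measurable_coin[of "b + i"] by (simp add: measurable_def)
  then show ?thesis
    unfolding coin_flips_def by (intro measurable_PiM_single') (auto simp: space_PiM PiE_iff)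
qed

lemma measurable_number [measurable]: "number b \<in> measurable coin_flips (count_space UNIV)"
proof (induction b)
  case (Suc b)
  note Suc [measurable]
  show ?case by simp
qed simp

lemma measurable_block:
  assumes "\<And>k. F k \<in> borel_measurable coin_flips"
  shows "(\<lambda>\<omega>. F (number b \<omega>) (skip b \<omega>)) \<in> borel_measurable coin_flips"
  by (rule measurable_compose_countable'[where I = UNIV and g = "number b"])
    (auto intro!: measurable_compose[OF measurable_skip assms])

text \<open>Prepending a fair coin to a random sequence reproduces the measure on sequences, so the
  first flip is independent of the shifted sequence.\<close>

lemma nn_integral_coin:
  fixes F :: "bool \<Rightarrow> (nat \<Rightarrow> bool) \<Rightarrow> ennreal"
  assumes F [measurable]: "\<And>x. F x \<in> borel_measurable coin_flips"
  shows "(\<integral>\<^sup>+\<omega>. F (\<omega> 0) (skip 1 \<omega>) \<partial>coin_flips) =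
    ((\<integral>\<^sup>+\<omega>. F False \<omega> \<partial>coin_flips) + (\<integral>\<^sup>+\<omega>. F True \<omega> \<partial>coin_flips)) / 2"
proof -
  let ?B = "measure_pmf (bernoulli_pmf (1/2))"
  interpret coin_step: pair_prob_space ?B coin_flips
    unfolding coin_flips_def by unfold_locales
  have m: "(\<lambda>\<omega>. F (\<omega> 0) (skip 1 \<omega>)) \<in> borel_measurable coin_flips"
    by (rule measurable_compose_countable'[where I = UNIV and g = "\<lambda>\<omega>. \<omega> 0"])
      (auto intro!: measurable_compose[OF measurable_skip F])
  have c [measurable]: "(\<lambda>(s, \<omega>). case_nat s \<omega>) \<in> measurable (?B \<Otimes>\<^sub>M coin_flips) coin_flips"
    unfolding coin_flips_def by measurable
  have "(\<integral>\<^sup>+\<omega>. F (\<omega> 0) (skip 1 \<omega>) \<partial>coin_flips) =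
      (\<integral>\<^sup>+\<omega>. F (\<omega> 0) (skip 1 \<omega>) \<partial>distr (?B \<Otimes>\<^sub>M coin_flips) coin_flips (\<lambda>(s, \<omega>). case_nat s \<omega>))"
    using coin_flips.PiM_iter by (simp add: coin_flips_def)
  also have "\<dots> = (\<integral>\<^sup>+p. F (fst p) (snd p) \<partial>(?B \<Otimes>\<^sub>M coin_flips))"
    by (subst nn_integral_distr[OF c]) (use m in \<open>simp_all add: skip_def split_beta\<close>)
  also have "\<dots> = (\<integral>\<^sup>+s. \<integral>\<^sup>+\<omega>. F s \<omega> \<partial>coin_flips \<partial>?B)"
  proof -
    have "(\<lambda>p. F (fst p) (snd p)) \<in> borel_measurable (?B \<Otimes>\<^sub>M coin_flips)"
      by (rule measurable_compose_countable'[where I = UNIV and g = fst])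
        (auto intro!: measurable_compose[OF measurable_snd F])
    from coin_pair.M1.nn_integral_fst[OF this] show ?thesis by simp
  qed
  also have "\<dots> = ((\<integral>\<^sup>+\<omega>. F False \<omega> \<partial>coin_flips) + (\<integral>\<^sup>+\<omega>. F True \<omega> \<partial>coin_flips)) / 2"
    by (subst nn_integral_measure_pmf_finite)
      (auto simp: UNIV_bool set_pmf_eq divide_ennreal_def inverse_ennreal
        distrib_right add.commute ennreal_divide_numeral)
  finally show ?thesis .
qed

lemma sum_lessThan_double:
  fixes f :: "nat \<Rightarrow> 'a :: comm_monoid_add"
  shows "(\<Sum>k<2 * m. f k) = (\<Sum>k<m. f (2 * k)) + (\<Sum>k<m. f (1 + 2 * k))"
  by (induction m) (simp_all add: ac_simps)

text \<open>The block is uniformly distributed and independent of the unread bits. The first flip is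
  the least significant bit, so the induction splits the sum into even and odd indices.\<close>

lemma nn_integral_block:
  fixes F :: "nat \<Rightarrow> (nat \<Rightarrow> bool) \<Rightarrow> ennreal"
  assumes [measurable]: "\<And>k. F k \<in> borel_measurable coin_flips"
  shows "(\<integral>\<^sup>+\<omega>. F (number b \<omega>) (skip b \<omega>) \<partial>coin_flips) =
    (\<Sum>k<2^b. \<integral>\<^sup>+\<omega>. F k \<omega> \<partial>coin_flips) / 2 ^ b"
  using assms
proof (induction b arbitrary: F)
  case 0
  then show ?case by (simp add: skip_def divide_ennreal_def)
next
  case (Suc b)
  let ?I = "\<lambda>k. \<integral>\<^sup>+\<omega>. F k \<omega> \<partial>coin_flips"
  let ?F = "\<lambda>x \<omega>. F (of_bool x + 2 * number b \<omega>) (skip b \<omega>)"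
  have "(\<integral>\<^sup>+\<omega>. F (number (Suc b) \<omega>) (skip (Suc b) \<omega>) \<partial>coin_flips) =
      (\<integral>\<^sup>+\<omega>. ?F (\<omega> 0) (skip 1 \<omega>) \<partial>coin_flips)"
    by (simp add: skip_skip)
  also have "\<dots> = ((\<integral>\<^sup>+\<omega>. ?F False \<omega> \<partial>coin_flips) + (\<integral>\<^sup>+\<omega>. ?F True \<omega> \<partial>coin_flips)) / 2"
    by (rule nn_integral_coin[where F = ?F], rule measurable_block[where F = "\<lambda>k. F (of_bool _ + 2 * k)"])
      (rule Suc.prems)
  also have "\<dots> = ((\<Sum>k<2^b. ?I (2 * k)) / 2 ^ b + (\<Sum>k<2^b. ?I (1 + 2 * k)) / 2 ^ b) / 2"
    using Suc.IH[of "\<lambda>k. F (2 * k)"] Suc.IH[of "\<lambda>k. F (1 + 2 * k)"] Suc.prems by simp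
  also have "\<dots> = ((\<Sum>k<2^b. ?I (2 * k)) + (\<Sum>k<2^b. ?I (1 + 2 * k))) / 2 ^ Suc b"
    by (simp add: divide_ennreal_def distrib_left distrib_right ennreal_inverse_mult power_less_top_ennreal mult_ac)
  also have "(\<Sum>k<2^b. ?I (2 * k)) + (\<Sum>k<2^b. ?I (1 + 2 * k)) = (\<Sum>k<2^Suc b. ?I k)"
    by (simp add: sum_lessThan_double)
  finally show ?case .
qed

subsection \<open>Random words\<close>

text \<open>
  A distribution on words over \<open>{1, -1}\<close>, given by integer weights: the branches of \<open>Br\<close> are the
  continuations after \<open>1\<close> and \<open>-1\<close>, and \<open>Lf 0\<close> is the empty distribution.
\<close>

datatype mix = Lf nat | Br mix mix

abbreviation "Fw t \<equiv> Br t (Lf 0)"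
abbreviation "Bw t \<equiv> Br (Lf 0) t"

fun weight :: "mix \<Rightarrow> nat" where
  "weight (Lf c) = c"
| "weight (Br l r) = weight l + weight r"

fun pick :: "mix \<Rightarrow> nat \<Rightarrow> int list" where
  "pick (Lf c) k = []"
| "pick (Br l r) k = (if k < weight l then 1 # pick l k else - 1 # pick r (k - weight l))"

fun total :: "mix \<Rightarrow> (int list \<Rightarrow> nat) \<Rightarrow> nat" where
  "total (Lf c) f = c * f []"
| "total (Br l r) f = total l (\<lambda>w. f (1 # w)) + total r (\<lambda>w. f (- 1 # w))"

text \<open>A pruned branch \<open>Lf 0\<close> is exempt from the constraint because
  \<open>pick\<close> never enters it for an index below the total weight.\<close>

fun ends_at :: "nat \<Rightarrow> int \<Rightarrow> mix \<Rightarrow> bool" where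
  "ends_at n d (Lf c) = (c = 0 \<or> n = 0 \<and> d = 0)"
| "ends_at n d (Br l r) = (n > 0 \<and> ends_at (n - 1) (d - 1) l \<and> ends_at (n - 1) (d + 1) r)"

text \<open>
  Both words are read simultaneously, and \<open>d\<close> is the signed distance still to be closed. If it
  never becomes 0, \<open>hit\<close> is the length of the shorter word.
\<close>

fun hit :: "int \<Rightarrow> int list \<Rightarrow> int list \<Rightarrow> nat" where
  "hit d (x # xs) (y # ys) = (if d = 0 then 0 else Suc (hit (d - x + y) xs ys))"
| "hit d xs ys = 0"

fun meets :: "int \<Rightarrow> int list \<Rightarrow> int list \<Rightarrow> bool" where
  "meets d (x # xs) (y # ys) = (d = 0 \<or> meets (d - x + y) xs ys)"
| "meets d xs ys = (d = 0)"

text \<open>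
  Most pairs of words meet early, so recursion on pairs of subtrees visits only a few thousand
  nodes when there are more than 100000 pairs of words.
\<close>

fun hits :: "int \<Rightarrow> int \<Rightarrow> mix \<Rightarrow> mix \<Rightarrow> nat" where
  "hits s d (Br l r) (Br l' r') =
     (if d = 0 then 0 else (weight l + weight r) * (weight l' + weight r') +
       hits s (d - 1 + s) l l' + hits s (d - 1 - s) l r' +
       hits s (d + 1 + s) r l' + hits s (d + 1 - s) r r')"
| "hits s d X Y = 0"

fun misses :: "int \<Rightarrow> int \<Rightarrow> mix \<Rightarrow> mix \<Rightarrow> nat" where
  "misses s d (Br l r) (Br l' r') =
     (if d = 0 then 0 else
       misses s (d - 1 + s) l l' + misses s (d - 1 - s) l r' +
       misses s (d + 1 + s) r l' + misses s (d + 1 - s) r r')"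
| "misses s d X Y = (if d = 0 then 0 else weight X * weight Y)"

text \<open>A leaf of weight \<open>c\<close> is selected by exactly \<open>c\<close> indices, so a
  uniform index realizes the weighted distribution.\<close>

lemma sum_pick: "(\<Sum>k<weight t. f (pick t k)) = total t f"
proof (induction t arbitrary: f)
  case (Br l r)
  have "(\<Sum>k<weight l + m. f (pick (Br l r) k)) =
      total l (\<lambda>w. f (1 # w)) + (\<Sum>k<m. f (- 1 # pick r k))" for m
    by (induction m) (simp_all add: Br.IH(1)[symmetric])
  then show ?case by (simp add: Br.IH(2)[symmetric])
qed simp

lemma ends_at_pick:
  assumes "ends_at n d t" "k < weight t"
  shows "length (pick t k) = n" "sum_list (pick t k) = d" "set (pick t k) \<subseteq> {- 1, 1}"
proof -
  have "length (pick t k) = n \<and> sum_list (pick t k) = d \<and> set (pick t k) \<subseteq> {- 1, 1}"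
    using assms
  proof (induction t arbitrary: n d k)
    case (Br l r)
    show ?case
      using Br.prems Br.IH(1)[of "n - 1" "d - 1" k] Br.IH(2)[of "n - 1" "d + 1" "k - weight l"]
      by (cases "k < weight l") auto
  qed auto
  then show "length (pick t k) = n" "sum_list (pick t k) = d" "set (pick t k) \<subseteq> {- 1, 1}" by auto
qed

lemma total_const: "total t (\<lambda>_. c) = weight t * c"
  by (induction t) (simp_all add: algebra_simps)

lemma total_add: "total t (\<lambda>w. f w + g w) = total t f + total t g"
  by (induction t arbitrary: f g) (simp_all add: algebra_simps)

lemma total_Suc: "total t (\<lambda>w. Suc (f w)) = weight t + total t f"
  using total_add[of t "\<lambda>_. 1" f] by (simp add: total_const)

text \<open>At a pair of nodes with a nonzero gap every pair of words below pays one step, which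
  accounts for the product of the weights. The sign \<open>s\<close> reflects the second word, so
  that one table serves for both relative directions.\<close>

lemma total_hit:
  "total X (\<lambda>xs. total Y (\<lambda>ys. hit d xs (map ((*) s) ys))) = hits s d X Y"
  by (induction s d X Y rule: hits.induct)
    (auto simp: total_const total_add total_Suc algebra_simps)

lemma meets_Nil: "meets d [] ys \<longleftrightarrow> d = 0" "meets d xs [] \<longleftrightarrow> d = 0"
  by (cases ys; simp) (cases xs; simp)

lemma total_misses:
  "total X (\<lambda>xs. total Y (\<lambda>ys. of_bool (\<not> meets d xs (map ((*) s) ys)))) = misses s d X Y"
  by (induction s d X Y rule: misses.induct)
    (auto simp: total_const total_add meets_Nil algebra_simps)

lemma meets_hit:
  assumes "meets d xs ys" "length xs = length ys"
  shows "hit d xs ys \<le> length xs"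
    "sum_list (take (hit d xs ys) xs) - sum_list (take (hit d xs ys) ys) = d"
  using assms by (induction d xs ys rule: meets.induct) auto

lemma not_meets_hit:
  assumes "\<not> meets d xs ys" "length xs = length ys"
  shows "hit d xs ys = length xs" "sum_list xs - sum_list ys \<noteq> d"
  using assms by (induction d xs ys rule: meets.induct) auto

text \<open>Reflecting the line and exchanging the two robots preserves the signed gap.\<close>

lemma hit_uminus: "hit d (map uminus xs) (map uminus ys) = hit d ys xs"
  by (induction d ys xs rule: hit.induct) (auto simp: algebra_simps)

lemma meets_uminus: "meets d (map uminus xs) (map uminus ys) = meets d ys xs"
  by (induction d ys xs rule: meets.induct) (auto simp: algebra_simps)


subsection \<open>Trajectories\<close>

text \<open>The fraction of the time interval from \<open>k\<close> to \<open>k + 1\<close> that has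
  elapsed at time \<open>t\<close>. It makes a polyline a sum of weighted increments, without a case
  distinction on the current segment.\<close>

definition ramp :: "real \<Rightarrow> nat \<Rightarrow> real" where
  "ramp t k = max 0 (min 1 (t - real k))"

definition polyline :: "(nat \<Rightarrow> complex) \<Rightarrow> real \<Rightarrow> complex" where
  "polyline z t = z 0 + (\<Sum>k<nat \<lceil>t\<rceil>. of_real (ramp t k) * (z (Suc k) - z k))"

lemma sum_ramp: "t \<ge> 0 \<Longrightarrow> (\<Sum>k<K. ramp t k) = min t (real K)"
  by (induction K) (auto simp: ramp_def)

lemma polyline_eq:
  assumes "nat \<lceil>t\<rceil> \<le> K"
  shows "polyline z t = z 0 + (\<Sum>k<K. of_real (ramp t k) * (z (Suc k) - z k))"
proof -
  have "ramp t k = 0" if "k \<ge> nat \<lceil>t\<rceil>" for k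
  proof -
    from that have "t \<le> real k" by linarith
    then show ?thesis by (simp add: ramp_def)
  qed
  then show ?thesis
    using assms unfolding polyline_def
    by (intro arg_cong2[where f = "(+)"] refl sum.mono_neutral_left) auto
qed

lemma polyline_of_nat: "polyline z (real m) = z m"
proof -
  have "polyline z (real m) = z 0 + (\<Sum>k<m. z (Suc k) - z k)"
    by (subst polyline_eq[of _ m]) (auto simp: ramp_def intro!: sum.cong)
  then show ?thesis by (simp add: sum_lessThan_telescope)
qed

text \<open>Each ramp is monotone in time and the ramps at \<open>t\<close> add up to
  \<open>t\<close>, so the increments enter the difference with nonnegative coefficients of sum
  \<open>t - s\<close>.\<close>

lemma dist_polyline:
  assumes "\<And>k. dist (z (Suc k)) (z k) \<le> 1" "s \<ge> 0" "s \<le> t"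
  shows "dist (polyline z t) (polyline z s) \<le> t - s"
proof -
  define K where "K = nat \<lceil>t\<rceil>"
  have K: "nat \<lceil>t\<rceil> \<le> K" "nat \<lceil>s\<rceil> \<le> K" "t \<le> real K"
    using assms by (auto simp: K_def intro!: nat_mono ceiling_mono) linarith
  have mono: "ramp s k \<le> ramp t k" for k
    using assms by (auto simp: ramp_def)
  have "polyline z t - polyline z s = (\<Sum>k<K. of_real (ramp t k - ramp s k) * (z (Suc k) - z k))"
    using K by (simp add: polyline_eq[of _ K] sum_subtractf[symmetric] left_diff_distrib)
  also have "norm \<dots> \<le> (\<Sum>k<K. ramp t k - ramp s k)"
    using assms(1) mono
    by (intro sum_norm_le) (simp add: norm_mult dist_norm mult_left_le del: of_real_diff)
  also have "\<dots> = t - s"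
    using K assms by (simp add: sum_subtractf sum_ramp)
  finally show ?thesis by (simp add: dist_norm)
qed

lemma lipschitz_polyline:
  assumes "\<And>k. dist (z (Suc k)) (z k) \<le> 1"
  shows "1-lipschitz_on {0..} (polyline z)"
proof (rule lipschitz_onI)
  fix s t :: real assume "s \<in> {0..}" "t \<in> {0..}"
  then show "dist (polyline z s) (polyline z t) \<le> 1 * dist s t"
    using dist_polyline[of z s t] dist_polyline[of z t s] assms
    by (cases "s \<le> t") (auto simp: dist_commute dist_real_def)
qed simp

subsection \<open>The chain of chords\<close>

text \<open>Half the angle under which a chord of length 2 is seen from \<open>O\<close>.\<close>

definition half_angle :: "real \<Rightarrow> real" where
  "half_angle \<rho> = arcsin (1 / \<rho>)"

text \<open>Even indices are the vertices of the chain, odd indices the midpoints of its chords.\<close>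

definition chain :: "real \<Rightarrow> int \<Rightarrow> complex" where
  "chain \<rho> m = of_real (if even m then \<rho> else sqrt (\<rho>\<^sup>2 - 1)) * cis (of_int m * half_angle \<rho>)"

lemma half_angle:
  assumes "\<rho> > 1"
  shows "\<rho> * sin (half_angle \<rho>) = 1" "\<rho> * cos (half_angle \<rho>) = sqrt (\<rho>\<^sup>2 - 1)"
proof -
  have "0 \<le> 1 / \<rho>" "1 / \<rho> \<le> 1" using assms by simp_all
  then have bounds: "- 1 \<le> 1 / \<rho>" "1 / \<rho> \<le> 1" by linarith+
  have s: "sin (half_angle \<rho>) = 1 / \<rho>" "cos (half_angle \<rho>) = sqrt (1 - (1 / \<rho>)\<^sup>2)"
    using bounds by (simp_all add: half_angle_def cos_arcsin)
  show "\<rho> * sin (half_angle \<rho>) = 1" using s assms by simp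
  have "\<rho> * sqrt (1 - (1 / \<rho>)\<^sup>2) = sqrt (\<rho>\<^sup>2 * (1 - (1 / \<rho>)\<^sup>2))"
    using assms by (simp add: real_sqrt_mult)
  also have "\<rho>\<^sup>2 * (1 - (1 / \<rho>)\<^sup>2) = \<rho>\<^sup>2 - 1"
    using assms by (simp add: field_simps)
  finally show "\<rho> * cos (half_angle \<rho>) = sqrt (\<rho>\<^sup>2 - 1)" using s by simp
qed

text \<open>\<open>O\<close>, a vertex and the midpoint of an adjacent chord form a right triangle
  with hypotenuse \<open>\<rho>\<close> and legs \<open>sqrt (\<rho>\<^sup>2 - 1)\<close> and 1.
  Steps into and out of a vertex are mirror images, whence the conjugation in
  \<open>leg'\<close>.\<close>

lemma dist_chain_Suc:
  assumes "\<rho> > 1"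
  shows "dist (chain \<rho> (m + 1)) (chain \<rho> m) = 1"
proof -
  define \<phi> where "\<phi> = half_angle \<rho>"
  define h where "h = sqrt (\<rho>\<^sup>2 - 1)"
  note trig = half_angle[OF assms, folded \<phi>_def h_def]
  have "h * sin \<phi> = (\<rho> * sin \<phi>) * cos \<phi>"
    unfolding trig(2)[symmetric] by (simp only: mult_ac)
  then have sq: "h * sin \<phi> = cos \<phi>"
    unfolding trig(1) by simp
  have leg: "norm (of_real h * cis \<phi> - of_real \<rho>) = 1"
  proof -
    have "of_real h * cis \<phi> - of_real \<rho> = Complex (h * cos \<phi> - \<rho>) (h * sin \<phi>)"
      by (simp add: complex_eq_iff)
    moreover have "h * cos \<phi> - \<rho> = - sin \<phi>"
    proof -
      have "h * cos \<phi> - \<rho> = \<rho> * ((cos \<phi>)\<^sup>2 - 1)"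
        using trig by (simp add: power2_eq_square algebra_simps)
      also have "(cos \<phi>)\<^sup>2 - 1 = - (sin \<phi> * sin \<phi>)"
        by (simp add: cos_squared_eq power2_eq_square[symmetric])
      also have "\<rho> * - (sin \<phi> * sin \<phi>) = - (\<rho> * sin \<phi>) * sin \<phi>"
        by simp
      finally show ?thesis using trig by simp
    qed
    ultimately show ?thesis
      by (simp add: sq complex_norm)
  qed
  have leg': "norm (of_real \<rho> - of_real h * cis (- \<phi>)) = 1"
  proof -
    have "of_real \<rho> - of_real h * cis (- \<phi>) = - cnj (of_real h * cis \<phi> - of_real \<rho>)"
      by (simp add: cis_cnj)
    then show ?thesis using leg by (metis complex_mod_cnj norm_minus_cancel)
  qed
  have cis_Suc: "cis (of_int (m + 1) * \<phi>) = cis (of_int m * \<phi>) * cis \<phi>"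
    and cis_pred: "cis (of_int m * \<phi>) = cis (of_int (m + 1) * \<phi>) * cis (- \<phi>)"
    by (simp_all add: cis_mult algebra_simps)
  show ?thesis
  proof (cases "even m")
    case True
    then have "chain \<rho> (m + 1) = of_real h * cis (of_int (m + 1) * \<phi>)"
      "chain \<rho> m = of_real \<rho> * cis (of_int m * \<phi>)"
      by (simp_all add: chain_def \<phi>_def h_def)
    then have "chain \<rho> (m + 1) - chain \<rho> m = cis (of_int m * \<phi>) * (of_real h * cis \<phi> - of_real \<rho>)"
      unfolding cis_Suc by (simp only: right_diff_distrib mult_ac)
    then show ?thesis by (simp add: dist_norm norm_mult leg)
  next
    case False
    then have "chain \<rho> (m + 1) = of_real \<rho> * cis (of_int (m + 1) * \<phi>)"
      "chain \<rho> m = of_real h * cis (of_int m * \<phi>)"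
      by (simp_all add: chain_def \<phi>_def h_def)
    then have "chain \<rho> (m + 1) - chain \<rho> m =
        cis (of_int (m + 1) * \<phi>) * (of_real \<rho> - of_real h * cis (- \<phi>))"
      unfolding cis_pred by (simp only: right_diff_distrib mult_ac)
    then show ?thesis by (simp add: dist_norm norm_mult leg')
  qed
qed

section \<open>Instances as two numberings of one chain\<close>

text \<open>A plane isometry fixing \<open>O\<close> multiplies by \<open>U 1\<close>, possibly
  after conjugation; in polar form conjugation only negates the angle, which \<open>\<sigma>\<close>
  records.\<close>

lemma orthogonal_transformation_complex:
  assumes "orthogonal_transformation (U :: complex \<Rightarrow> complex)"
  obtains \<sigma> :: int where "\<bar>\<sigma>\<bar> = 1" "\<And>r x :: real. U (of_real r * cis x) = U 1 * of_real r * cis (\<sigma> * x)"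
proof -
  have lin: "linear U" and inner: "\<And>v w. U v \<bullet> U w = v \<bullet> w"
    using assms by (auto simp: orthogonal_transformation_def)
  obtain p q where pq: "U 1 = Complex p q" by (cases "U 1")
  obtain r s where rs: "U \<i> = Complex r s" by (cases "U \<i>")
  have eqs: "p * p + q * q = 1" "r * r + s * s = 1" "p * r + q * s = 0"
    using inner[of 1 1] inner[of \<i> \<i>] inner[of 1 \<i>] by (auto simp: pq rs inner_complex_def)
  \<comment> \<open>The determinant of \<open>U\<close>; the identity below is Lagrange's and gives
    \<open>k * k = 1\<close>.\<close>
  define k where "k = p * s - q * r"
  have "k * k = (p * p + q * q) * (r * r + s * s) - (p * r + q * s) * (p * r + q * s)"
    unfolding k_def by algebra
  then have "k * k = 1" using eqs by simp
  then have k: "k = 1 \<or> k = - 1" by algebra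
  have "p * k = (p * p + q * q) * s - q * (p * r + q * s)"
    "- q * k = (p * p + q * q) * r - p * (p * r + q * s)" unfolding k_def by algebra+
  then have "s = p * k" "r = - q * k" using eqs by simp_all
  then have Ui: "U \<i> = U 1 * (of_real k * \<i>)" by (simp add: pq rs complex_eq_iff)
  have U: "U (of_real a * cis x) = U 1 * of_real a * (of_real (cos x) + of_real (k * sin x) * \<i>)" for a x
  proof -
    have "of_real a * cis x = (a * cos x) *\<^sub>R 1 + (a * sin x) *\<^sub>R \<i>"
      by (simp add: complex_eq_iff)
    then have "U (of_real a * cis x) = (a * cos x) *\<^sub>R U 1 + (a * sin x) *\<^sub>R U \<i>"
      by (simp add: linear_add[OF lin] linear_scale[OF lin])
    also have "\<dots> = U 1 * of_real a * (of_real (cos x) + of_real (k * sin x) * \<i>)"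
      unfolding Ui by (simp add: scaleR_conv_of_real algebra_simps)
    finally show ?thesis .
  qed
  from k obtain \<sigma> :: int where \<sigma>: "\<bar>\<sigma>\<bar> = 1" "k = of_int \<sigma>"
    by (metis abs_1 abs_minus_cancel of_int_1 of_int_minus)
  have "of_real (cos x) + of_real (k * sin x) * \<i> = cis (of_int \<sigma> * x)" for x :: real
    using k by (auto simp: complex_eq_iff \<sigma>(2)[symmetric])
  with U \<sigma>(1) show thesis by (intro that[of \<sigma>]) simp_all
qed

text \<open>The distance 2 forces the frames to differ by a rotation \<open>w\<close> through twice
  the half angle in one of the two senses, that is, by two chain steps. Both robots thus walk on the
  same chain, with indices shifted by 2 up to orientation.\<close>

lemma rendezvous_on_chain:
  assumes "(U, V) \<in> SRD_instances \<rho>" "\<rho> > 1"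
  obtains \<sigma> \<tau> :: int where "\<bar>\<sigma>\<bar> = 1" "\<bar>\<tau>\<bar> = 1"
    "\<And>m m'. \<sigma> * m - \<tau> * m' = 2 \<Longrightarrow> U (chain \<rho> m) = V (chain \<rho> m')"
proof -
  have orth: "orthogonal_transformation U" "orthogonal_transformation V"
    and dist: "dist (U (of_real \<rho>)) (V (of_real \<rho>)) = 2"
    using assms by (auto simp: SRD_instances_def)
  obtain \<sigma> :: int where \<sigma>: "\<bar>\<sigma>\<bar> = 1" "\<And>r x :: real. U (of_real r * cis x) = U 1 * of_real r * cis (\<sigma> * x)"
    using orthogonal_transformation_complex[OF orth(1)] by blast
  obtain \<tau> :: int where \<tau>: "\<bar>\<tau>\<bar> = 1" "\<And>r x :: real. V (of_real r * cis x) = V 1 * of_real r * cis (\<tau> * x)"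
    using orthogonal_transformation_complex[OF orth(2)] by blast
  have norms: "norm (U 1) = 1" "norm (V 1) = 1"
    using orth by (simp_all add: orthogonal_transformation)
  define \<phi> where "\<phi> = half_angle \<rho>"
  define w where "w = V 1 / U 1"
  have V1: "V 1 = U 1 * w" and norm_w: "norm w = 1"
    using norms by (auto simp: w_def norm_divide)
  have Re_Im: "(Re w)\<^sup>2 + (Im w)\<^sup>2 = 1"
    using norm_w by (simp add: cmod_def)
  have "U (of_real \<rho>) - V (of_real \<rho>) = U 1 * of_real \<rho> * (1 - w)"
    using \<sigma>(2)[of \<rho> 0] \<tau>(2)[of \<rho> 0] by (simp add: V1 algebra_simps)
  then have "\<rho> * norm (1 - w) = 2"
    using dist norms assms by (simp add: dist_norm norm_mult)
  then have "(\<rho> * norm (1 - w))\<^sup>2 = 4" by simp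
  then have "\<rho>\<^sup>2 * (norm (1 - w))\<^sup>2 = 4" by (simp add: power_mult_distrib)
  moreover have "(norm (1 - w))\<^sup>2 = 2 - 2 * Re w"
    using Re_Im by (simp add: cmod_power2 power2_diff)
  moreover have "\<rho>\<^sup>2 * (sin \<phi>)\<^sup>2 = 1"
    using half_angle(1)[OF assms(2)] by (simp add: \<phi>_def flip: power_mult_distrib)
  ultimately have "\<rho>\<^sup>2 * (2 - 2 * Re w) = \<rho>\<^sup>2 * (4 * (sin \<phi>)\<^sup>2)" by simp
  then have Re_w: "Re w = cos (2 * \<phi>)"
    using assms by (simp add: cos_double_sin)
  then have "(Im w)\<^sup>2 = (sin (2 * \<phi>))\<^sup>2"
    using Re_Im by (simp add: sin_squared_eq)
  then have "w = cis (of_int (2 * 1) * \<phi>) \<or> w = cis (of_int (2 * - 1) * \<phi>)"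
    using Re_w by (auto simp: power2_eq_iff complex_eq_iff)
  then obtain \<eta> :: int where \<eta>: "\<bar>\<eta>\<bar> = 1" "w = cis (of_int (2 * \<eta>) * \<phi>)"
    by (metis abs_1 abs_minus_cancel)
  show thesis
  \<comment> \<open>The side \<open>\<eta>\<close> of the peer is absorbed into both signs, so that
    the gap is always \<open>+2\<close>.\<close>
  proof (rule that[of "\<eta> * \<sigma>" "\<eta> * \<tau>"])
    fix m m' assume eq: "\<eta> * \<sigma> * m - \<eta> * \<tau> * m' = 2"
    have "\<eta> = 1 \<or> \<eta> = - 1" using \<eta>(1) by linarith
    then have m: "\<sigma> * m = 2 * \<eta> + \<tau> * m'" using eq by auto
    have "\<sigma> = 1 \<or> \<sigma> = - 1" "\<tau> = 1 \<or> \<tau> = - 1" using \<sigma>(1) \<tau>(1) by linarith+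
    then have odd: "odd \<sigma>" "odd \<tau>" by auto
    \<comment> \<open>Equal parity puts both points at the same distance from \<open>O\<close>; only
      the angles remain to be compared.\<close>
    have "even m \<longleftrightarrow> even m'"
      using arg_cong[OF m, of even] odd by simp
    moreover have "of_int \<sigma> * (of_int m * \<phi>) = of_int (2 * \<eta>) * \<phi> + of_int \<tau> * (of_int m' * \<phi>)"
      using arg_cong[OF m, of "\<lambda>i. of_int i * \<phi>"] by (simp add: algebra_simps)
    then have "cis (of_int \<sigma> * (of_int m * \<phi>)) = w * cis (of_int \<tau> * (of_int m' * \<phi>))"
      by (simp only: \<eta>(2) cis_mult)
    moreover obtain r where "chain \<rho> m = of_real r * cis (of_int m * \<phi>)"
      "chain \<rho> m' = of_real r * cis (of_int m' * \<phi>)"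
      using \<open>even m \<longleftrightarrow> even m'\<close> by (simp add: chain_def flip: \<phi>_def)
    ultimately show "U (chain \<rho> m) = V (chain \<rho> m')"
      by (simp add: \<sigma>(2) \<tau>(2) V1)
  qed (use \<sigma>(1) \<tau>(1) \<eta>(1) in \<open>simp_all add: abs_mult\<close>)
qed

text \<open>A constant can be pulled out of the supremum over all instances only if there is one:
  the empty supremum is 0.\<close>

lemma SRD_instances_nonempty:
  assumes "\<rho> > 1"
  shows "SRD_instances \<rho> \<noteq> {}"
proof -
  define w where "w = cis (2 * half_angle \<rho>)"
  have "orthogonal_transformation ((*) w)"
    by (simp add: orthogonal_transformation w_def norm_mult linear_times)
  moreover have "dist (of_real \<rho>) (w * of_real \<rho>) = 2"
  proof -
    define h where "h = half_angle \<rho>"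
    have double: "cos (2 * h) = 1 - 2 * sin h * sin h" "sin (2 * h) = 2 * sin h * cos h"
      by (simp_all add: cos_double_sin sin_double power2_eq_square)
    have "of_real \<rho> - w * of_real \<rho> = - 2 * \<i> * of_real (\<rho> * sin h) * cis h"
      by (rule complex_eqI) (simp_all add: w_def double flip: h_def, simp_all add: algebra_simps)
    then show ?thesis
      using half_angle(1)[OF assms] by (simp add: dist_norm norm_mult h_def del: of_real_mult)
  qed
  ultimately have "((\<lambda>x. x), (*) w) \<in> SRD_instances \<rho>"
    by (simp add: SRD_instances_def)
  then show ?thesis by blast
qed

subsection \<open>Delaying an algorithm\<close>

lemma INF_const_add_ennreal:
  fixes f :: "'i \<Rightarrow> ennreal"
  assumes "c < \<top>"
  shows "(INF i. c + f i) = c + (INF i. f i)"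
proof (rule antisym)
  have "(INF i. c + f i) - c \<le> f j" for j
    using assms INF_lower[of j UNIV "\<lambda>i. c + f i"] by (auto simp: ennreal_minus_le_iff)
  then have "(INF i. c + f i) - c \<le> (INF i. f i)"
    by (rule INF_greatest)
  then show "(INF i. c + f i) \<le> c + (INF i. f i)"
    using assms by (auto simp: ennreal_minus_le_iff)
qed (auto intro!: INF_greatest add_left_mono INF_lower)

text \<open>Different starting points exclude a meeting while both robots wait.\<close>

lemma rendezvous_time_delay:
  assumes "p 0 \<noteq> q 0" "D \<ge> 0"
  shows "rendezvous_time (\<lambda>t. p (max 0 (t - D))) (\<lambda>t. q (max 0 (t - D))) =
    ennreal D + rendezvous_time p q"
proof -
  \<comment> \<open>The default \<open>\<top>\<close> extends the infimum to all reals, where it can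
    be reindexed by the shift through \<open>D\<close>.\<close>
  have INF: "rendezvous_time p q = (INF t. if 0 \<le> t \<and> p t = q t then ennreal t else \<top>)" for p q
    unfolding rendezvous_time_def
  proof (intro antisym INF_greatest)
    fix t assume "t \<in> {t. 0 \<le> t \<and> p t = q t}"
    then show "(INF t. if 0 \<le> t \<and> p t = q t then ennreal t else \<top>) \<le> ennreal t"
      by (intro INF_lower2[of t]) auto
  qed (auto intro: INF_lower)
  let ?f = "\<lambda>t. if 0 \<le> t \<and> p (max 0 (t - D)) = q (max 0 (t - D)) then ennreal t else \<top>"
  have "(INF t. ?f t) = Inf (?f ` range ((+) D))"
    by (simp only: surj_plus)
  also have "\<dots> = (INF t. ?f (D + t))"
    by (simp only: image_image)
  also have "\<dots> = (INF t. ennreal D + (if 0 \<le> t \<and> p t = q t then ennreal t else \<top>))"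
    using assms by (intro INF_cong refl) (auto simp: max_def)
  finally show ?thesis
    unfolding INF by (simp only: INF_const_add_ennreal ennreal_less_top)
qed

lemma competitive_delay:
  assumes "\<rho> > 1" "SRD_algorithm \<rho> X" "competitive_ratio \<rho> X \<le> ennreal c"
  shows "\<exists>Y. SRD_algorithm \<rho> Y \<and> competitive c \<rho> Y"
proof -
  obtain r where r: "competitive_ratio \<rho> X = ennreal r" "0 \<le> r"
    using assms(3) by (metis ennreal_cases ennreal_less_top leD)
  \<comment> \<open>The maximum matters only for negative \<open>c\<close>, where
    \<open>ennreal c\<close> is 0 and so is \<open>r\<close>.\<close>
  define D where "D = max 0 (c - r)"
  have "D \<ge> 0" by (simp add: D_def)
  define Y where "Y = (\<lambda>\<omega> t. X \<omega> (max 0 (t - D)))"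
  have c: "ennreal c = ennreal D + ennreal r"
  proof (cases "r \<le> c")
    case True
    then show ?thesis using r by (simp add: D_def flip: ennreal_plus)
  next
    case False
    then have "r = 0" using assms(3) r by (auto simp: ennreal_le_iff2)
    then show ?thesis using False by (simp add: D_def ennreal_neg)
  qed
  have X: "X \<omega> 0 = of_real \<rho>" "1-lipschitz_on {0..} (X \<omega>)"
    "t \<ge> 0 \<Longrightarrow> (\<lambda>\<omega>. X \<omega> t) \<in> borel_measurable coin_flips" for \<omega> t
    using assms(2) by (auto simp: SRD_algorithm_def)
  have "SRD_algorithm \<rho> Y"
    unfolding SRD_algorithm_def
  proof (intro conjI allI impI)
    fix \<omega> show "Y \<omega> 0 = of_real \<rho>" using X(1) by (simp add: Y_def D_def)
    show "1-lipschitz_on {0..} (Y \<omega>)"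
    proof (rule lipschitz_onI)
      fix s t :: real assume "s \<in> {0..}" "t \<in> {0..}"
      have "dist (Y \<omega> s) (Y \<omega> t) \<le> 1 * dist (max 0 (s - D)) (max 0 (t - D))"
        unfolding Y_def by (rule lipschitz_onD[OF X(2)]) auto
      also have "\<dots> \<le> 1 * dist s t" by (auto simp: dist_real_def)
      finally show "dist (Y \<omega> s) (Y \<omega> t) \<le> 1 * dist s t" .
    qed simp
  next
    fix t :: real assume "t \<ge> 0"
    then show "(\<lambda>\<omega>. Y \<omega> t) \<in> borel_measurable coin_flips" unfolding Y_def by (intro X(3)) simp
  qed
  moreover have "competitive_ratio \<rho> Y = (SUP I\<in>SRD_instances \<rho>. ennreal D + expected_rendezvous_time X I)"
    unfolding competitive_ratio_def
  proof (rule SUP_cong[OF refl])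
    fix I assume I: "I \<in> SRD_instances \<rho>"
    obtain U V where UV: "I = (U, V)" by (cases I)
    have "U (X \<omega> 0) \<noteq> V (X \<omega>' 0)" for \<omega> \<omega>'
      using I by (auto simp: UV X(1) SRD_instances_def)
    then have "expected_rendezvous_time Y I =
        (\<integral>\<^sup>+p. ennreal D + rendezvous_time (\<lambda>t. U (X (fst p) t)) (\<lambda>t. V (X (snd p) t)) \<partial>(coin_flips \<Otimes>\<^sub>M coin_flips))"
      unfolding expected_rendezvous_time_def UV Y_def prod.case case_prod_beta
      using \<open>D \<ge> 0\<close> rendezvous_time_delay[of "\<lambda>t. U (X (fst p) t)" "\<lambda>t. V (X (snd p) t)" D for p]
      by (intro nn_integral_cong) simp
    also have "\<dots> = ennreal D + expected_rendezvous_time X I"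
      unfolding expected_rendezvous_time_def UV case_prod_beta fst_conv snd_conv
      by (intro nn_integral_const_add coin_pair.prob_space_axioms) simp
    finally show "expected_rendezvous_time Y I = ennreal D + expected_rendezvous_time X I" .
  qed
  then have "competitive_ratio \<rho> Y = ennreal D + competitive_ratio \<rho> X"
    using SRD_instances_nonempty[OF assms(1)]
    by (simp add: ennreal_SUP_add_right competitive_ratio_def)
  ultimately show ?thesis
    using c r by (auto simp: competitive_def)
qed

subsection \<open>The strategy on the line\<close>

text \<open>
  Found by numerical optimization of the quotient \<open>C / (1 - p)\<close> over all distributions on the words
  of length 20 and sum 2, followed by pruning of rare words and rounding to multiples of \<open>2\<^sup>-\<^sup>1\<^sup>1\<close>.
\<close>

definition table :: mix where
  "table =
  Br (Br (Br (Br (Bw (Bw (Bw (Bw (Bw (Bw (Br (Bw (Bw (Bw (Fw (Fw (Fw (Fw (Fw (Fw (Lf 4))))))))))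
  (Br (Br (Bw (Bw (Fw (Fw (Fw (Fw (Fw (Lf 5)))))))) (Fw (Fw (Bw (Fw (Fw (Fw (Fw (Lf 5))))))))) (Fw
  (Fw (Fw (Fw (Fw (Bw (Fw (Fw (Lf 6))))))))))))))))) (Bw (Br (Bw (Bw (Br (Bw (Bw (Bw (Bw (Bw (Fw
  (Fw (Fw (Fw (Fw (Fw (Lf 7)))))))))))) (Br (Br (Bw (Bw (Bw (Bw (Fw (Fw (Fw (Fw (Fw (Lf
  5)))))))))) (Br (Bw (Bw (Br (Bw (Fw (Fw (Fw (Fw (Lf 6)))))) (Fw (Fw (Fw (Fw (Fw (Lf 4)))))))))
  (Br (Br (Bw (Bw (Fw (Fw (Fw (Fw (Lf 9))))))) (Fw (Fw (Br (Bw (Fw (Fw (Lf 4)))) (Fw (Fw (Fw (Lf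
  6)))))))) (Fw (Fw (Fw (Fw (Fw (Br (Bw (Lf 6)) (Fw (Lf 6))))))))))) (Br (Br (Br (Bw (Bw (Br (Bw
  (Fw (Fw (Fw (Lf 6))))) (Fw (Fw (Fw (Fw (Lf 8)))))))) (Br (Br (Bw (Bw (Fw (Fw (Fw (Lf 7)))))) (Fw
  (Fw (Bw (Fw (Fw (Lf 7))))))) (Fw (Fw (Fw (Fw (Br (Bw (Lf 5)) (Fw (Lf 5))))))))) (Fw (Fw (Fw (Br
  (Bw (Bw (Fw (Fw (Lf 6))))) (Fw (Fw (Bw (Fw (Lf 6)))))))))) (Fw (Fw (Fw (Fw (Fw (Br (Bw (Bw (Fw
  (Lf 6)))) (Fw (Fw (Bw (Lf 6))))))))))))))) (Br (Br (Bw (Bw (Br (Bw (Bw (Bw (Br (Bw (Fw (Fw (Fw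
  (Fw (Lf 6)))))) (Fw (Fw (Fw (Fw (Fw (Lf 7)))))))))) (Br (Br (Bw (Bw (Br (Bw (Fw (Fw (Fw (Lf
  5))))) (Fw (Fw (Fw (Fw (Lf 8)))))))) (Br (Br (Bw (Bw (Fw (Fw (Fw (Lf 8)))))) (Fw (Fw (Bw (Fw (Fw
  (Lf 8))))))) (Fw (Fw (Fw (Fw (Br (Bw (Lf 6)) (Fw (Lf 6))))))))) (Fw (Fw (Br (Br (Bw (Bw (Fw (Fw
  (Lf 11))))) (Fw (Fw (Bw (Fw (Lf 10)))))) (Fw (Fw (Fw (Fw (Bw (Lf 8))))))))))))) (Br (Br (Bw (Bw
  (Bw (Br (Bw (Br (Bw (Fw (Fw (Fw (Lf 4))))) (Fw (Fw (Fw (Fw (Lf 6))))))) (Fw (Fw (Fw (Br (Fw (Bw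
  (Lf 5))) (Fw (Fw (Lf 5))))))))))) (Br (Bw (Br (Bw (Br (Bw (Bw (Fw (Fw (Fw (Lf 6)))))) (Fw (Fw
  (Bw (Fw (Fw (Lf 8)))))))) (Fw (Fw (Br (Br (Bw (Bw (Fw (Lf 4)))) (Bw (Fw (Fw (Lf 5))))) (Fw (Fw
  (Fw (Bw (Lf 6)))))))))) (Fw (Fw (Br (Br (Bw (Bw (Br (Bw (Fw (Lf 4))) (Fw (Fw (Lf 5)))))) (Br (Fw
  (Bw (Bw (Fw (Lf 6))))) (Fw (Fw (Fw (Bw (Lf 6))))))) (Fw (Fw (Fw (Fw (Bw (Bw (Lf 7))))))))))))
  (Fw (Fw (Br (Br (Bw (Bw (Bw (Br (Bw (Fw (Fw (Lf 5)))) (Fw (Fw (Fw (Lf 6)))))))) (Br (Br (Bw (Bw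
  (Bw (Fw (Fw (Lf 5)))))) (Br (Bw (Fw (Bw (Fw (Lf 5))))) (Fw (Fw (Fw (Bw (Lf 6))))))) (Fw (Fw (Br
  (Bw (Bw (Fw (Lf 8)))) (Fw (Fw (Bw (Lf 7))))))))) (Fw (Fw (Br (Br (Bw (Bw (Bw (Fw (Lf 7))))) (Bw
  (Fw (Fw (Bw (Lf 7)))))) (Fw (Fw (Fw (Bw (Bw (Lf 6)))))))))))))) (Br (Fw (Br (Br (Bw (Bw (Br (Bw
  (Bw (Bw (Fw (Fw (Fw (Lf 9))))))) (Br (Br (Bw (Bw (Fw (Fw (Lf 9))))) (Fw (Fw (Bw (Fw (Lf 9))))))
  (Fw (Fw (Fw (Fw (Bw (Lf 10)))))))))) (Br (Br (Bw (Bw (Bw (Br (Bw (Fw (Fw (Lf 5)))) (Fw (Fw (Fw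
  (Lf 5)))))))) (Br (Bw (Fw (Bw (Bw (Fw (Fw (Lf 8))))))) (Fw (Fw (Br (Bw (Bw (Fw (Lf 7)))) (Fw (Fw
  (Bw (Lf 6))))))))) (Fw (Fw (Br (Br (Bw (Bw (Bw (Fw (Lf 7))))) (Br (Bw (Bw (Fw (Lf 5)))) (Fw (Fw
  (Bw (Lf 10)))))) (Fw (Fw (Br (Bw (Bw (Lf 6))) (Fw (Bw (Lf 4))))))))))) (Fw (Fw (Br (Br (Bw (Bw
  (Bw (Bw (Fw (Fw (Lf 6))))))) (Br (Bw (Bw (Fw (Bw (Fw (Lf 7)))))) (Fw (Br (Bw (Bw (Fw (Lf 7))))
  (Fw (Fw (Bw (Lf 6)))))))) (Fw (Fw (Br (Bw (Bw (Br (Bw (Lf 4)) (Fw (Lf 4))))) (Fw (Fw (Bw (Bw (Lf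
  6))))))))))))) (Fw (Fw (Fw (Fw (Fw (Br (Br (Bw (Bw (Bw (Bw (Fw (Lf 6)))))) (Br (Bw (Bw (Fw (Bw
  (Lf 5))))) (Fw (Fw (Bw (Bw (Lf 5))))))) (Fw (Fw (Fw (Bw (Bw (Bw (Lf 4)))))))))))))))))) (Br (Br
  (Bw (Bw (Bw (Br (Br (Bw (Bw (Bw (Bw (Bw (Fw (Fw (Fw (Fw (Fw (Lf 6))))))))))) (Br (Bw (Bw (Br (Bw
  (Bw (Fw (Fw (Fw (Fw (Lf 5))))))) (Fw (Fw (Fw (Bw (Fw (Fw (Lf 7)))))))))) (Br (Br (Bw (Br (Bw (Bw
  (Fw (Fw (Fw (Lf 5)))))) (Fw (Fw (Bw (Fw (Fw (Lf 6)))))))) (Fw (Fw (Br (Bw (Bw (Fw (Fw (Lf 4)))))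
  (Fw (Fw (Bw (Fw (Lf 5))))))))) (Fw (Fw (Fw (Fw (Br (Bw (Bw (Fw (Lf 6)))) (Fw (Fw (Bw (Lf
  5)))))))))))) (Br (Br (Br (Br (Bw (Bw (Bw (Bw (Fw (Fw (Fw (Lf 5)))))))) (Bw (Br (Br (Bw (Bw (Fw
  (Fw (Lf 5))))) (Fw (Fw (Bw (Fw (Lf 5)))))) (Fw (Fw (Fw (Fw (Bw (Lf 6))))))))) (Br (Br (Bw (Fw
  (Bw (Bw (Fw (Fw (Lf 6))))))) (Fw (Fw (Fw (Bw (Bw (Fw (Lf 5)))))))) (Fw (Fw (Fw (Fw (Fw (Bw (Bw
  (Lf 6)))))))))) (Fw (Fw (Fw (Br (Bw (Bw (Bw (Fw (Fw (Lf 5)))))) (Fw (Fw (Bw (Bw (Fw (Lf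
  5))))))))))) (Fw (Fw (Fw (Fw (Fw (Br (Bw (Bw (Bw (Fw (Lf 5))))) (Fw (Bw (Fw (Bw (Lf
  5)))))))))))))))) (Br (Br (Bw (Bw (Bw (Br (Br (Bw (Bw (Bw (Bw (Fw (Fw (Fw (Fw (Lf 4))))))))) (Br
  (Bw (Bw (Fw (Bw (Fw (Fw (Fw (Lf 5)))))))) (Fw (Br (Bw (Bw (Fw (Fw (Fw (Lf 6)))))) (Fw (Fw (Bw
  (Fw (Fw (Lf 5)))))))))) (Br (Br (Br (Bw (Bw (Bw (Fw (Fw (Fw (Lf 6))))))) (Br (Bw (Fw (Fw (Bw (Fw
  (Lf 5)))))) (Fw (Fw (Fw (Fw (Bw (Lf 5)))))))) (Fw (Fw (Fw (Bw (Fw (Bw (Fw (Lf 5))))))))) (Fw (Fw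
  (Fw (Fw (Fw (Bw (Bw (Fw (Lf 6)))))))))))))) (Br (Br (Bw (Bw (Bw (Br (Bw (Br (Bw (Fw (Fw (Bw (Fw
  (Lf 4)))))) (Fw (Fw (Fw (Fw (Bw (Lf 5)))))))) (Fw (Fw (Fw (Br (Bw (Bw (Fw (Lf 5)))) (Fw (Fw (Bw
  (Lf 5)))))))))))) (Br (Br (Bw (Bw (Bw (Br (Bw (Fw (Fw (Bw (Fw (Lf 4)))))) (Fw (Fw (Fw (Fw (Bw
  (Lf 5)))))))))) (Br (Bw (Br (Bw (Fw (Bw (Bw (Fw (Fw (Lf 5))))))) (Fw (Fw (Br (Bw (Bw (Fw (Lf
  5)))) (Fw (Fw (Bw (Lf 4))))))))) (Fw (Fw (Br (Br (Bw (Bw (Bw (Fw (Lf 5))))) (Bw (Fw (Fw (Bw (Lf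
  5)))))) (Fw (Fw (Fw (Bw (Bw (Lf 5))))))))))) (Fw (Fw (Br (Br (Bw (Bw (Br (Bw (Bw (Fw (Lf 4))))
  (Fw (Fw (Bw (Lf 5))))))) (Br (Br (Bw (Bw (Bw (Fw (Lf 5))))) (Fw (Bw (Fw (Bw (Lf 4)))))) (Fw (Fw
  (Fw (Bw (Bw (Lf 5)))))))) (Fw (Fw (Fw (Fw (Bw (Bw (Bw (Lf 6))))))))))))) (Fw (Fw (Br (Br (Br (Bw
  (Bw (Bw (Bw (Bw (Fw (Fw (Lf 5)))))))) (Bw (Br (Br (Bw (Bw (Bw (Fw (Lf 4))))) (Fw (Bw (Fw (Bw (Lf
  5)))))) (Fw (Fw (Fw (Bw (Bw (Lf 6))))))))) (Br (Br (Bw (Br (Bw (Bw (Fw (Bw (Lf 4))))) (Fw (Fw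
  (Bw (Bw (Lf 5))))))) (Fw (Fw (Bw (Fw (Bw (Bw (Lf 4)))))))) (Fw (Fw (Fw (Fw (Bw (Bw (Bw (Lf
  5)))))))))) (Fw (Fw (Fw (Br (Bw (Bw (Fw (Bw (Bw (Lf 6)))))) (Fw (Fw (Bw (Bw (Bw (Lf
  5))))))))))))))) (Fw (Fw (Br (Br (Br (Bw (Bw (Bw (Bw (Fw (Bw (Bw (Fw (Fw (Lf 7)))))))))) (Br (Bw
  (Bw (Bw (Fw (Br (Bw (Bw (Fw (Lf 4)))) (Fw (Fw (Bw (Lf 4))))))))) (Br (Br (Bw (Bw (Bw (Fw (Fw (Bw
  (Lf 6))))))) (Br (Bw (Fw (Bw (Fw (Bw (Lf 6)))))) (Fw (Fw (Fw (Bw (Bw (Lf 5)))))))) (Fw (Fw (Br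
  (Bw (Bw (Fw (Bw (Lf 7))))) (Fw (Fw (Bw (Bw (Lf 6))))))))))) (Br (Br (Br (Bw (Bw (Bw (Br (Bw (Bw
  (Fw (Lf 4)))) (Fw (Fw (Bw (Lf 4)))))))) (Br (Bw (Br (Bw (Bw (Bw (Fw (Lf 4))))) (Fw (Fw (Bw (Bw
  (Lf 5))))))) (Fw (Fw (Br (Bw (Bw (Bw (Lf 4)))) (Fw (Bw (Bw (Lf 4))))))))) (Fw (Fw (Bw (Fw (Fw
  (Bw (Bw (Bw (Lf 7)))))))))) (Fw (Fw (Fw (Fw (Br (Bw (Bw (Bw (Bw (Lf 5))))) (Fw (Bw (Bw (Bw (Lf
  5)))))))))))) (Fw (Fw (Fw (Br (Bw (Br (Bw (Bw (Fw (Bw (Bw (Lf 5)))))) (Fw (Fw (Bw (Bw (Bw (Lf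
  5)))))))) (Fw (Fw (Fw (Bw (Bw (Bw (Bw (Lf 4))))))))))))))))) (Fw (Fw (Br (Br (Br (Bw (Bw (Bw (Bw
  (Br (Bw (Bw (Bw (Fw (Fw (Fw (Lf 5))))))) (Br (Br (Bw (Bw (Fw (Fw (Lf 6))))) (Fw (Fw (Bw (Fw (Lf
  5)))))) (Fw (Fw (Fw (Fw (Bw (Lf 6)))))))))))) (Br (Bw (Bw (Bw (Br (Bw (Br (Fw (Bw (Bw (Fw (Lf
  4))))) (Fw (Fw (Fw (Bw (Lf 4))))))) (Fw (Fw (Fw (Fw (Bw (Bw (Lf 5))))))))))) (Br (Br (Bw (Bw (Bw
  (Fw (Bw (Bw (Fw (Fw (Lf 7))))))))) (Br (Bw (Br (Bw (Bw (Fw (Fw (Bw (Lf 6)))))) (Fw (Fw (Br (Bw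
  (Bw (Lf 5))) (Fw (Bw (Lf 5)))))))) (Fw (Fw (Br (Bw (Bw (Br (Bw (Lf 4)) (Fw (Lf 4))))) (Fw (Fw
  (Bw (Bw (Lf 6)))))))))) (Br (Fw (Br (Br (Bw (Bw (Bw (Bw (Fw (Lf 8)))))) (Br (Bw (Bw (Fw (Bw (Lf
  7))))) (Fw (Fw (Bw (Bw (Lf 9))))))) (Fw (Fw (Bw (Fw (Bw (Bw (Lf 8))))))))) (Fw (Fw (Fw (Fw (Fw
  (Bw (Bw (Bw (Lf 7))))))))))))) (Br (Br (Br (Bw (Bw (Bw (Bw (Br (Bw (Fw (Bw (Fw (Lf 5))))) (Fw
  (Fw (Fw (Bw (Lf 5)))))))))) (Br (Bw (Bw (Br (Bw (Br (Bw (Bw (Fw (Lf 4)))) (Fw (Fw (Bw (Lf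
  4)))))) (Fw (Fw (Fw (Bw (Bw (Lf 5))))))))) (Br (Br (Br (Bw (Bw (Bw (Bw (Fw (Lf 5)))))) (Br (Bw
  (Bw (Fw (Bw (Lf 5))))) (Fw (Fw (Bw (Bw (Lf 7))))))) (Fw (Fw (Bw (Fw (Bw (Bw (Lf 6)))))))) (Fw
  (Fw (Fw (Fw (Bw (Bw (Bw (Lf 5))))))))))) (Fw (Br (Br (Bw (Bw (Bw (Br (Bw (Bw (Fw (Lf 4)))) (Fw
  (Fw (Bw (Lf 5)))))))) (Br (Br (Bw (Bw (Bw (Bw (Fw (Lf 5)))))) (Br (Bw (Bw (Fw (Bw (Lf 5))))) (Fw
  (Fw (Bw (Bw (Lf 4))))))) (Fw (Fw (Fw (Bw (Bw (Bw (Lf 5))))))))) (Fw (Fw (Fw (Fw (Bw (Bw (Bw (Bw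
  (Lf 5)))))))))))) (Fw (Fw (Fw (Br (Br (Bw (Bw (Bw (Bw (Br (Bw (Lf 5)) (Fw (Lf 5))))))) (Br (Bw
  (Bw (Fw (Bw (Bw (Lf 8)))))) (Fw (Fw (Bw (Bw (Bw (Lf 8)))))))) (Fw (Fw (Fw (Bw (Bw (Bw (Bw (Lf
  8)))))))))))))) (Fw (Fw (Fw (Br (Br (Bw (Bw (Br (Bw (Bw (Bw (Bw (Fw (Lf 4)))))) (Br (Bw (Bw (Fw
  (Bw (Lf 6))))) (Fw (Fw (Bw (Bw (Lf 7))))))))) (Br (Bw (Br (Bw (Bw (Fw (Bw (Bw (Lf 6)))))) (Fw
  (Fw (Bw (Bw (Bw (Lf 7)))))))) (Fw (Fw (Br (Bw (Bw (Bw (Bw (Lf 6))))) (Fw (Bw (Bw (Bw (Lf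
  5)))))))))) (Fw (Fw (Br (Bw (Bw (Br (Bw (Bw (Bw (Lf 5)))) (Fw (Bw (Bw (Lf 5))))))) (Fw (Fw (Bw
  (Bw (Bw (Bw (Lf 6))))))))))))))))))) (Fw (Fw (Br (Br (Bw (Bw (Bw (Bw (Br (Bw (Bw (Br (Bw (Bw (Fw
  (Fw (Fw (Fw (Lf 5))))))) (Fw (Fw (Bw (Fw (Fw (Fw (Lf 6)))))))))) (Br (Br (Bw (Bw (Bw (Fw (Fw (Fw
  (Fw (Lf 6)))))))) (Fw (Br (Bw (Bw (Fw (Fw (Fw (Lf 4)))))) (Fw (Fw (Bw (Fw (Fw (Lf 4))))))))) (Fw
  (Fw (Fw (Br (Bw (Bw (Fw (Fw (Lf 5))))) (Fw (Fw (Bw (Fw (Lf 4))))))))))))))) (Br (Bw (Br (Bw (Bw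
  (Bw (Bw (Fw (Br (Bw (Bw (Fw (Fw (Fw (Lf 6)))))) (Fw (Fw (Bw (Fw (Fw (Lf 6)))))))))))) (Br (Br
  (Bw (Bw (Bw (Bw (Bw (Fw (Fw (Fw (Fw (Lf 5)))))))))) (Br (Bw (Bw (Br (Bw (Bw (Fw (Fw (Fw (Lf
  4)))))) (Fw (Fw (Bw (Fw (Fw (Lf 6))))))))) (Br (Br (Bw (Bw (Bw (Fw (Fw (Fw (Lf 7))))))) (Fw (Br
  (Bw (Bw (Fw (Fw (Lf 5))))) (Fw (Fw (Bw (Fw (Lf 5)))))))) (Fw (Fw (Fw (Fw (Bw (Bw (Fw (Lf
  5))))))))))) (Br (Fw (Br (Bw (Bw (Br (Bw (Bw (Fw (Fw (Lf 6))))) (Fw (Fw (Bw (Fw (Lf 7))))))))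
  (Br (Br (Bw (Bw (Bw (Fw (Fw (Lf 6)))))) (Fw (Bw (Fw (Bw (Fw (Lf 5))))))) (Fw (Fw (Fw (Bw (Bw (Fw
  (Lf 5)))))))))) (Fw (Fw (Fw (Fw (Bw (Fw (Fw (Bw (Bw (Lf 5)))))))))))))) (Br (Br (Br (Bw (Bw (Bw
  (Br (Bw (Bw (Bw (Fw (Fw (Fw (Lf 6))))))) (Br (Br (Bw (Bw (Fw (Fw (Lf 6))))) (Fw (Fw (Bw (Fw (Lf
  6)))))) (Fw (Fw (Fw (Fw (Bw (Lf 6))))))))))) (Br (Bw (Br (Bw (Bw (Bw (Bw (Fw (Fw (Fw (Lf
  5)))))))) (Br (Bw (Br (Bw (Fw (Bw (Fw (Lf 5))))) (Fw (Fw (Fw (Bw (Lf 5))))))) (Fw (Fw (Fw (Bw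
  (Bw (Fw (Lf 5)))))))))) (Br (Br (Br (Bw (Bw (Bw (Bw (Fw (Fw (Lf 6))))))) (Br (Bw (Bw (Fw (Bw (Fw
  (Lf 5)))))) (Br (Fw (Bw (Bw (Fw (Lf 7))))) (Fw (Fw (Fw (Bw (Lf 5)))))))) (Fw (Fw (Bw (Fw (Bw (Bw
  (Fw (Lf 6))))))))) (Fw (Fw (Fw (Bw (Fw (Fw (Bw (Bw (Lf 7)))))))))))) (Fw (Br (Br (Bw (Bw (Br (Bw
  (Bw (Bw (Fw (Fw (Lf 5)))))) (Br (Fw (Bw (Bw (Fw (Lf 6))))) (Fw (Fw (Fw (Bw (Lf 5))))))))) (Fw
  (Br (Bw (Bw (Br (Bw (Bw (Fw (Lf 5)))) (Fw (Fw (Bw (Lf 5))))))) (Fw (Bw (Fw (Fw (Bw (Bw (Lf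
  5)))))))))) (Fw (Fw (Fw (Fw (Bw (Bw (Fw (Bw (Bw (Lf 4))))))))))))) (Fw (Fw (Fw (Fw (Br (Bw (Bw
  (Bw (Br (Bw (Bw (Fw (Lf 5)))) (Fw (Fw (Bw (Lf 5)))))))) (Br (Br (Bw (Bw (Bw (Bw (Fw (Lf 5))))))
  (Fw (Bw (Bw (Fw (Bw (Lf 4))))))) (Fw (Fw (Fw (Bw (Bw (Bw (Lf 4)))))))))))))))) (Fw (Fw (Br (Br
  (Bw (Bw (Bw (Bw (Br (Bw (Bw (Bw (Fw (Fw (Fw (Lf 6))))))) (Br (Br (Bw (Bw (Fw (Fw (Lf 6))))) (Fw
  (Fw (Bw (Fw (Lf 5)))))) (Fw (Fw (Fw (Fw (Bw (Lf 5)))))))))))) (Br (Bw (Bw (Br (Bw (Bw (Br (Fw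
  (Bw (Bw (Fw (Lf 5))))) (Fw (Fw (Fw (Bw (Lf 5)))))))) (Fw (Fw (Br (Bw (Bw (Bw (Fw (Lf 5))))) (Bw
  (Fw (Fw (Bw (Lf 5))))))))))) (Br (Br (Bw (Bw (Br (Bw (Bw (Fw (Bw (Fw (Lf 6)))))) (Br (Fw (Bw (Bw
  (Fw (Lf 6))))) (Fw (Fw (Fw (Bw (Lf 5))))))))) (Fw (Br (Bw (Bw (Bw (Fw (Fw (Bw (Lf 6))))))) (Fw
  (Bw (Fw (Fw (Bw (Bw (Lf 5)))))))))) (Fw (Fw (Fw (Br (Bw (Bw (Bw (Bw (Fw (Lf 5)))))) (Br (Bw (Bw
  (Fw (Bw (Lf 5))))) (Fw (Fw (Bw (Bw (Lf 5))))))))))))) (Fw (Br (Br (Br (Bw (Bw (Bw (Bw (Bw (Bw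
  (Fw (Fw (Lf 5))))))))) (Bw (Br (Bw (Bw (Bw (Fw (Fw (Bw (Lf 6))))))) (Br (Fw (Bw (Bw (Bw (Fw (Lf
  6)))))) (Fw (Fw (Fw (Bw (Bw (Lf 5)))))))))) (Fw (Br (Bw (Bw (Br (Bw (Bw (Fw (Bw (Lf 5))))) (Fw
  (Fw (Bw (Bw (Lf 4)))))))) (Fw (Fw (Bw (Bw (Fw (Bw (Bw (Lf 6))))))))))) (Fw (Fw (Fw (Bw (Fw (Fw
  (Bw (Bw (Bw (Bw (Lf 5)))))))))))))))))))) (Fw (Fw (Fw (Fw (Br (Br (Bw (Bw (Br (Bw (Bw (Bw (Bw
  (Bw (Bw (Fw (Fw (Fw (Fw (Lf 4))))))))))) (Br (Bw (Bw (Br (Bw (Bw (Bw (Fw (Fw (Fw (Lf 6)))))))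
  (Br (Br (Bw (Bw (Fw (Fw (Lf 6))))) (Fw (Fw (Bw (Fw (Lf 7)))))) (Fw (Fw (Fw (Fw (Bw (Lf
  8)))))))))) (Br (Br (Bw (Bw (Br (Bw (Bw (Fw (Fw (Lf 6))))) (Br (Fw (Bw (Fw (Lf 7)))) (Fw (Fw (Fw
  (Lf 4)))))))) (Br (Br (Bw (Bw (Bw (Fw (Fw (Lf 6)))))) (Br (Bw (Fw (Bw (Fw (Lf 5))))) (Fw (Fw (Fw
  (Bw (Lf 5))))))) (Fw (Fw (Br (Bw (Bw (Fw (Lf 6)))) (Fw (Fw (Bw (Lf 4))))))))) (Br (Fw (Br (Br
  (Bw (Bw (Bw (Fw (Lf 6))))) (Br (Bw (Bw (Fw (Lf 4)))) (Fw (Fw (Bw (Lf 8)))))) (Fw (Fw (Bw (Fw (Bw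
  (Lf 6)))))))) (Fw (Fw (Fw (Fw (Fw (Bw (Bw (Lf 4)))))))))))))) (Br (Br (Bw (Bw (Bw (Bw (Br (Bw
  (Bw (Bw (Fw (Fw (Fw (Lf 5))))))) (Br (Br (Bw (Bw (Fw (Fw (Lf 5))))) (Fw (Fw (Bw (Fw (Lf 4))))))
  (Fw (Fw (Fw (Fw (Bw (Lf 5)))))))))))) (Br (Bw (Bw (Br (Bw (Bw (Fw (Bw (Bw (Fw (Fw (Lf 7))))))))
  (Br (Br (Bw (Bw (Br (Bw (Fw (Lf 4))) (Fw (Fw (Lf 4)))))) (Fw (Fw (Bw (Bw (Fw (Lf 6))))))) (Fw
  (Fw (Fw (Fw (Bw (Bw (Lf 4))))))))))) (Br (Br (Bw (Bw (Br (Bw (Bw (Bw (Fw (Fw (Lf 7)))))) (Br (Br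
  (Bw (Bw (Fw (Lf 6)))) (Fw (Fw (Bw (Lf 4))))) (Fw (Fw (Fw (Bw (Lf 5))))))))) (Fw (Br (Bw (Bw (Br
  (Bw (Bw (Fw (Lf 6)))) (Fw (Fw (Bw (Lf 6))))))) (Fw (Bw (Fw (Fw (Bw (Bw (Lf 6)))))))))) (Fw (Fw
  (Fw (Bw (Fw (Fw (Bw (Bw (Bw (Lf 7))))))))))))) (Br (Br (Br (Bw (Bw (Bw (Br (Bw (Bw (Br (Bw (Fw
  (Lf 4))) (Fw (Fw (Lf 6)))))) (Br (Br (Bw (Bw (Fw (Lf 8)))) (Fw (Fw (Bw (Lf 5))))) (Fw (Fw (Fw
  (Bw (Lf 6)))))))))) (Br (Br (Bw (Bw (Bw (Bw (Bw (Fw (Fw (Lf 5)))))))) (Br (Bw (Bw (Br (Bw (Bw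
  (Fw (Lf 5)))) (Fw (Fw (Bw (Lf 5))))))) (Fw (Br (Bw (Bw (Br (Bw (Lf 4)) (Fw (Lf 4))))) (Fw (Fw
  (Bw (Bw (Lf 5))))))))) (Fw (Br (Br (Bw (Bw (Bw (Bw (Fw (Lf 8)))))) (Br (Bw (Bw (Fw (Bw (Lf
  6))))) (Fw (Fw (Bw (Bw (Lf 6))))))) (Fw (Fw (Fw (Bw (Bw (Bw (Lf 4))))))))))) (Fw (Fw (Br (Bw (Bw
  (Br (Bw (Bw (Bw (Fw (Lf 6))))) (Fw (Fw (Bw (Bw (Lf 6)))))))) (Fw (Fw (Bw (Bw (Fw (Bw (Bw (Lf
  6)))))))))))) (Fw (Fw (Fw (Br (Br (Bw (Bw (Bw (Bw (Br (Bw (Lf 5)) (Fw (Lf 5))))))) (Br (Bw (Bw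
  (Fw (Bw (Bw (Lf 7)))))) (Fw (Fw (Bw (Bw (Bw (Lf 6)))))))) (Fw (Fw (Fw (Bw (Bw (Bw (Bw (Lf
  4))))))))))))))) (Fw (Br (Br (Br (Bw (Bw (Bw (Br (Bw (Bw (Bw (Br (Bw (Fw (Lf 4))) (Fw (Fw (Lf
  5))))))) (Br (Br (Bw (Bw (Bw (Fw (Lf 5))))) (Br (Bw (Bw (Fw (Lf 4)))) (Fw (Fw (Bw (Lf 6))))))
  (Fw (Fw (Br (Bw (Bw (Lf 6))) (Fw (Bw (Lf 4))))))))))) (Br (Br (Bw (Bw (Bw (Bw (Bw (Fw (Fw (Bw
  (Lf 6))))))))) (Br (Bw (Bw (Br (Bw (Bw (Fw (Bw (Lf 5))))) (Fw (Fw (Bw (Bw (Lf 6)))))))) (Br (Bw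
  (Fw (Bw (Fw (Bw (Bw (Lf 7))))))) (Fw (Fw (Fw (Bw (Bw (Bw (Lf 6)))))))))) (Br (Br (Br (Bw (Bw (Bw
  (Bw (Br (Bw (Lf 5)) (Fw (Lf 5))))))) (Br (Bw (Bw (Fw (Bw (Bw (Lf 7)))))) (Fw (Fw (Bw (Bw (Bw (Lf
  8)))))))) (Fw (Fw (Bw (Fw (Bw (Bw (Bw (Lf 7))))))))) (Fw (Fw (Fw (Fw (Bw (Bw (Bw (Bw (Lf
  8)))))))))))) (Fw (Br (Br (Br (Bw (Bw (Bw (Bw (Bw (Bw (Fw (Lf 6)))))))) (Br (Bw (Bw (Bw (Bw (Fw
  (Bw (Lf 6))))))) (Br (Bw (Bw (Fw (Bw (Bw (Lf 7)))))) (Fw (Fw (Bw (Bw (Bw (Lf 8))))))))) (Fw (Br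
  (Bw (Bw (Fw (Bw (Bw (Bw (Lf 7))))))) (Fw (Fw (Bw (Bw (Bw (Bw (Lf 6)))))))))) (Fw (Fw (Fw (Fw (Bw
  (Bw (Bw (Bw (Bw (Lf 4))))))))))))) (Fw (Fw (Fw (Fw (Fw (Bw (Bw (Fw (Bw (Bw (Bw (Bw (Lf
  6))))))))))))))))))))"

lemma weight_table: "weight table = 2 ^ 11"
  by (simp add: table_def)
lemma ends_at_table: "ends_at 20 2 table"
  by (simp add: table_def)
text \<open>Gap 2 with \<open>s = 1\<close> is left after equal first steps, gap 4 with
  \<open>s = - 1\<close> after outward ones. Divided by \<open>2^22\<close>, the values are the mean
  numbers of further steps in the phase, about 4.879 and 3.244.\<close>

lemma hits_table: "hits 1 2 table table = 20465191" "hits (- 1) 4 table table = 13608352"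
  by (simp_all add: table_def)
text \<open>The second count vanishes because a word and a reflected word, each of sum 2, together
  close the gap 4.\<close>

lemma misses_table: "misses 1 2 table table = 12962" "misses (- 1) 4 table table = 0"
  by (simp_all add: table_def)

text \<open>A phase uses 12 bits: one for the direction and 11 for the choice of the word.\<close>

definition word :: "nat \<Rightarrow> int list" where
  "word k = map ((*) (if even k then 1 else - 1)) (1 # map uminus (pick table (k div 2)))"

definition step :: "(nat \<Rightarrow> bool) \<Rightarrow> nat \<Rightarrow> int" where
  "step \<omega> j = word (number 12 (skip (12 * (j div 21)) \<omega>)) ! (j mod 21)"

definition pos :: "(nat \<Rightarrow> bool) \<Rightarrow> nat \<Rightarrow> int" where
  "pos \<omega> k = (\<Sum>j<k. step \<omega> j)"

text \<open>
  An upper bound for the time of the meeting within the first \<open>N\<close> phases. The signs \<open>\<sigma>\<close> and \<open>\<tau>\<close>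
  translate the private directions of the robots to a common one.
\<close>

fun bound :: "int \<Rightarrow> int \<Rightarrow> nat \<Rightarrow> (nat \<Rightarrow> bool) \<Rightarrow> (nat \<Rightarrow> bool) \<Rightarrow> nat" where
  "bound \<sigma> \<tau> 0 \<omega> \<omega>' = 0"
| "bound \<sigma> \<tau> (Suc N) \<omega> \<omega>' =
    (let xs = map ((*) \<sigma>) (word (number 12 \<omega>)); ys = map ((*) \<tau>) (word (number 12 \<omega>'))
     in hit 2 xs ys + (if meets 2 xs ys then 0 else bound \<sigma> \<tau> N (skip 12 \<omega>) (skip 12 \<omega>')))"

lemma map_mult_one: "map ((*) 1) xs = (xs :: int list)" "map ((*) (- 1)) xs = map uminus xs"
  by (simp_all add: map_idI)

lemma word_double: "word (2 * k) = 1 # map uminus (pick table k)" "word (1 + 2 * k) = - 1 # pick table k"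
  by (simp_all add: word_def map_mult_one comp_def)

lemma
  assumes "k < 2 ^ 12"
  shows length_word: "length (word k) = 21"
    and sum_list_word: "sum_list (word k) = - hd (word k)"
    and set_word: "set (word k) \<subseteq> {- 1, 1}"
proof -
  have k: "k div 2 < weight table" using assms by (simp add: weight_table)
  have sum: "sum_list (map uminus xs) = - sum_list xs" for xs :: "int list"
    by (induction xs) simp_all
  note pick = ends_at_pick[OF ends_at_table k]
  have "length (word k) = 21 \<and> sum_list (word k) = - hd (word k) \<and> set (word k) \<subseteq> {- 1, 1}"
  proof (cases "even k")
    case True
    then have "word k = 1 # map uminus (pick table (k div 2))"
      using word_double(1)[of "k div 2"] by simp
    then show ?thesis using pick by (auto simp: sum)
  next
    case False
    then have "word k = - 1 # pick table (k div 2)"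
      using word_double(2)[of "k div 2"] by simp
    then show ?thesis using pick by auto
  qed
  then show "length (word k) = 21" "sum_list (word k) = - hd (word k)" "set (word k) \<subseteq> {- 1, 1}"
    by auto
qed

section \<open>Positions across phases and the meeting dichotomy\<close>

lemma number_12_less: "number 12 \<omega> < 2 ^ 12"
  by (rule number_less)

lemma skip_0: "skip 0 \<omega> = \<omega>"
  by (simp add: skip_def)

lemma step_add: "step \<omega> (21 + j) = step (skip 12 \<omega>) j"
  by (simp add: step_def skip_skip)

lemma pos_add: "pos \<omega> (21 + k) = pos \<omega> 21 + pos (skip 12 \<omega>) k"
proof (induction k)
  case (Suc k)
  have "pos \<omega> (21 + Suc k) = pos \<omega> (21 + k) + step \<omega> (21 + k)"
    unfolding pos_def add_Suc_right by (rule sum.lessThan_Suc)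
  then show ?case unfolding Suc.IH step_add by (simp add: pos_def)
qed (simp add: pos_def)

lemma pos_block:
  assumes "k \<le> 21"
  shows "pos \<omega> k = sum_list (take k (word (number 12 \<omega>)))"
proof -
  have "pos \<omega> k = (\<Sum>j<k. word (number 12 \<omega>) ! j)"
    unfolding pos_def using assms by (intro sum.cong) (auto simp: step_def skip_0)
  then show ?thesis
    using assms length_word[OF number_12_less, of \<omega>]
    by (simp add: sum_list_sum_nth atLeast0LessThan)
qed

lemma abs_step: "\<bar>step \<omega> j\<bar> = 1"
proof -
  let ?w = "word (number 12 (skip (12 * (j div 21)) \<omega>))"
  have "?w ! (j mod 21) \<in> set ?w"
    by (rule nth_mem) (simp add: length_word[OF number_12_less])
  then show ?thesis
    using set_word[OF number_12_less] unfolding step_def by fastforce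
qed

lemma meets_0: "meets 0 xs ys"
  by (cases xs; cases ys) simp_all

lemma hit_0: "hit 0 xs ys = 0"
  by (cases xs; cases ys) simp_all

lemma sum_list_map_mult: "sum_list (map ((*) c) xs) = c * sum_list (xs :: int list)"
  by (induction xs) (simp_all add: algebra_simps)

text \<open>A failed phase costs 21 steps and restores the gap 2, so the claim for the remaining
  bits transfers with times shifted by 21. The crude alternative \<open>N\<close> suffices to make
  the bound diverge if no meeting is ever found.\<close>

lemma meeting_or_large:
  assumes "\<bar>\<sigma>\<bar> = 1" "\<bar>\<tau>\<bar> = 1"
  shows "(\<exists>k\<le>bound \<sigma> \<tau> N \<omega> \<omega>'. \<sigma> * pos \<omega> k - \<tau> * pos \<omega>' k = 2) \<or> N \<le> bound \<sigma> \<tau> N \<omega> \<omega>'"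
proof (induction N arbitrary: \<omega> \<omega>')
  case (Suc N)
  define xs where "xs = map ((*) \<sigma>) (word (number 12 \<omega>))"
  define ys where "ys = map ((*) \<tau>) (word (number 12 \<omega>'))"
  have len: "length xs = 21" "length ys = 21"
    by (simp_all add: xs_def ys_def length_word[OF number_12_less])
  have xs: "sum_list (take k xs) = \<sigma> * pos \<omega> k" if "k \<le> 21" for k
    using that by (simp add: xs_def pos_block take_map sum_list_map_mult)
  have ys: "sum_list (take k ys) = \<tau> * pos \<omega>' k" if "k \<le> 21" for k
    using that by (simp add: ys_def pos_block take_map sum_list_map_mult)
  have bound: "bound \<sigma> \<tau> (Suc N) \<omega> \<omega>' =
      hit 2 xs ys + (if meets 2 xs ys then 0 else bound \<sigma> \<tau> N (skip 12 \<omega>) (skip 12 \<omega>'))"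
    by (simp add: xs_def ys_def Let_def)
  show ?case
  proof (cases "meets 2 xs ys")
    case True
    then show ?thesis
      using meets_hit[OF True] len bound by (intro disjI1 exI[of _ "hit 2 xs ys"]) (simp add: xs ys)
  next
    case False
    have hd: "hd xs = \<sigma> * hd (word (number 12 \<omega>))" "hd ys = \<tau> * hd (word (number 12 \<omega>'))"
      using len by (auto simp: xs_def ys_def intro!: list.map_sel(1))
    have "sum_list xs = - hd xs" "sum_list ys = - hd ys"
      unfolding hd by (simp_all add: xs_def ys_def sum_list_map_mult sum_list_word[OF number_12_less])
    moreover have "\<bar>hd xs\<bar> = 1" "\<bar>hd ys\<bar> = 1"
    proof -
      have "\<bar>hd (word (number 12 \<omega>))\<bar> = 1" for \<omega>
        using set_word[OF number_12_less, of \<omega>] length_word[OF number_12_less, of \<omega>]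
          hd_in_set[of "word (number 12 \<omega>)"] by fastforce
      then show "\<bar>hd xs\<bar> = 1" "\<bar>hd ys\<bar> = 1" using assms by (simp_all add: hd abs_mult)
    qed
    \<comment> \<open>First steps towards each other close the gap 2 at once.\<close>
    moreover have "\<not> (hd xs = 1 \<and> hd ys = - 1)"
    proof
      assume "hd xs = 1 \<and> hd ys = - 1"
      then have "meets 2 xs ys" using len by (cases xs; cases ys) (auto simp: meets_0)
      with False show False by contradiction
    qed
    moreover have "sum_list xs - sum_list ys \<noteq> 2" "hit 2 xs ys = 21"
      using not_meets_hit[OF False] len by auto
    \<comment> \<open>Outward first steps would give displacements differing by exactly 2, a meeting
      at the end of the phase. Only equal first steps remain, and these give equal
      displacements.\<close>
    ultimately have "sum_list xs = sum_list ys" by linarith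
    then have eq: "\<sigma> * pos \<omega> 21 = \<tau> * pos \<omega>' 21" using xs[of 21] ys[of 21] len by simp
    have B: "bound \<sigma> \<tau> (Suc N) \<omega> \<omega>' = 21 + bound \<sigma> \<tau> N (skip 12 \<omega>) (skip 12 \<omega>')"
      using bound False \<open>hit 2 xs ys = 21\<close> by simp
    from Suc.IH[of "skip 12 \<omega>" "skip 12 \<omega>'"] show ?thesis
    proof
      assume "\<exists>k\<le>bound \<sigma> \<tau> N (skip 12 \<omega>) (skip 12 \<omega>').
        \<sigma> * pos (skip 12 \<omega>) k - \<tau> * pos (skip 12 \<omega>') k = 2"
      then obtain k where "k \<le> bound \<sigma> \<tau> N (skip 12 \<omega>) (skip 12 \<omega>')"
        "\<sigma> * pos (skip 12 \<omega>) k - \<tau> * pos (skip 12 \<omega>') k = 2" by blast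
      then show ?thesis
        using eq unfolding B by (intro disjI1 exI[of _ "21 + k"]) (simp add: pos_add distrib_left)
    qed (use B in simp)
  qed
qed simp

section \<open>Expected duration and failure probability of a phase\<close>

lemma bound_mono: "bound \<sigma> \<tau> N \<omega> \<omega>' \<le> bound \<sigma> \<tau> (Suc N) \<omega> \<omega>'"
  by (induction N arbitrary: \<omega> \<omega>') (simp_all add: Let_def)

text \<open>A sign only exchanges the words of the two directions, so the sum does not depend on
  \<open>\<sigma>\<close>. This is why all instances obey the same bound.\<close>

lemma sum_word:
  assumes "\<bar>\<sigma>\<bar> = 1"
  shows "(\<Sum>k<2^12. f (map ((*) \<sigma>) (word k))) = total table (\<lambda>u. f (1 # map uminus u) + f (- 1 # u))"
proof -
  have "(\<Sum>k<2 * weight table. f (map ((*) \<sigma>) (word k))) =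
      (\<Sum>k<weight table. f (1 # map uminus (pick table k)) + f (- 1 # pick table k))"
  proof -
    have "\<sigma> = 1 \<or> \<sigma> = - 1" using assms by linarith
    then show ?thesis
      by (auto simp: sum_lessThan_double word_double[simplified] sum.distrib map_mult_one comp_def)
  qed
  then show ?thesis
    by (simp add: weight_table flip: sum_pick)
qed

lemma total_swap: "total X (\<lambda>u. total Y (f u)) = total Y (\<lambda>v. total X (\<lambda>u. f u v))"
  unfolding sum_pick[symmetric] by (rule sum.swap)

lemma sum_sum_word:
  assumes "\<bar>\<sigma>\<bar> = 1" "\<bar>\<tau>\<bar> = 1"
  shows "(\<Sum>k<2^12. \<Sum>k'<2^12. f (map ((*) \<sigma>) (word k)) (map ((*) \<tau>) (word k'))) =
    total table (\<lambda>u. total table (\<lambda>v.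
      f (1 # map uminus u) (1 # map uminus v) + f (1 # map uminus u) (- 1 # v) +
      f (- 1 # u) (1 # map uminus v) + f (- 1 # u) (- 1 # v)))"
proof -
  have "(\<Sum>k<2^12. \<Sum>k'<2^12. f (map ((*) \<sigma>) (word k)) (map ((*) \<tau>) (word k'))) =
      (\<Sum>k<2^12. total table (\<lambda>v. f (map ((*) \<sigma>) (word k)) (1 # map uminus v) +
        f (map ((*) \<sigma>) (word k)) (- 1 # v)))"
    by (intro sum.cong refl sum_word assms)
  also have "\<dots> = total table (\<lambda>u.
      total table (\<lambda>v. f (1 # map uminus u) (1 # map uminus v) + f (1 # map uminus u) (- 1 # v)) +
      total table (\<lambda>v. f (- 1 # u) (1 # map uminus v) + f (- 1 # u) (- 1 # v)))"
    by (rule sum_word[OF assms(1), where f = "\<lambda>xs. total table (\<lambda>v. f xs (1 # map uminus v) + f xs (- 1 # v))"])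
  finally show ?thesis
    by (simp add: add.assoc flip: total_add)
qed

text \<open>The four pairs of first steps cost one step each and leave the gaps 2, 0, 4 and 2.
  Reflection turns the two cases of equal first steps into each other with the robots exchanged,
  hence the factor 2.\<close>

lemma sum_hit:
  assumes "\<bar>\<sigma>\<bar> = 1" "\<bar>\<tau>\<bar> = 1"
  shows "(\<Sum>k<2^12. \<Sum>k'<2^12. hit 2 (map ((*) \<sigma>) (word k)) (map ((*) \<tau>) (word k'))) =
    4 * (weight table)\<^sup>2 + 2 * hits 1 2 table table + hits (- 1) 4 table table"
proof -
  have "(\<Sum>k<2^12. \<Sum>k'<2^12. hit 2 (map ((*) \<sigma>) (word k)) (map ((*) \<tau>) (word k'))) =
      total table (\<lambda>u. total table (\<lambda>v.
        4 + hit 2 v u + hit 4 u (map uminus v) + hit 2 u v))"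
    unfolding sum_sum_word[OF assms, of "hit 2"] by (simp add: hit_uminus hit_0 add_ac eval_nat_numeral)
  also have "\<dots> = 4 * (weight table)\<^sup>2 + total table (\<lambda>u. total table (\<lambda>v. hit 2 v u)) +
      total table (\<lambda>u. total table (\<lambda>v. hit 4 u (map uminus v))) +
      total table (\<lambda>u. total table (\<lambda>v. hit 2 u v))"
    by (simp add: total_add total_const power2_eq_square)
  also have "total table (\<lambda>u. total table (\<lambda>v. hit 2 v u)) = total table (\<lambda>u. total table (\<lambda>v. hit 2 u v))"
    by (rule total_swap)
  finally show ?thesis
    by (simp add: total_hit[symmetric] map_mult_one)
qed

lemma sum_not_meets:
  assumes "\<bar>\<sigma>\<bar> = 1" "\<bar>\<tau>\<bar> = 1"
  shows "(\<Sum>k<2^12. \<Sum>k'<2^12. of_bool (\<not> meets 2 (map ((*) \<sigma>) (word k)) (map ((*) \<tau>) (word k')))) =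
    2 * misses 1 2 table table + misses (- 1) 4 table table"
proof -
  have "(\<Sum>k<2^12. \<Sum>k'<2^12. of_bool (\<not> meets 2 (map ((*) \<sigma>) (word k)) (map ((*) \<tau>) (word k')))) =
      total table (\<lambda>u. total table (\<lambda>v.
        of_bool (\<not> meets 2 v u) + of_bool (\<not> meets 4 u (map uminus v)) + of_bool (\<not> meets 2 u v)))"
    unfolding sum_sum_word[OF assms, of "\<lambda>xs ys. of_bool (\<not> meets 2 xs ys)"]
    by (simp add: meets_uminus meets_0 add_ac)
  also have "\<dots> = total table (\<lambda>u. total table (\<lambda>v. of_bool (\<not> meets 2 v u))) +
      total table (\<lambda>u. total table (\<lambda>v. of_bool (\<not> meets 4 u (map uminus v)))) +
      total table (\<lambda>u. total table (\<lambda>v. of_bool (\<not> meets 2 u v)))"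
    by (simp add: total_add)
  also have "total table (\<lambda>u. total table (\<lambda>v. of_bool (\<not> meets 2 v u))) =
      total table (\<lambda>u. total table (\<lambda>v. of_bool (\<not> meets 2 u v)))"
    by (rule total_swap)
  finally show ?thesis
    by (simp add: total_misses[symmetric] map_mult_one)
qed

lemma measurable_bound:
  "(\<lambda>p. bound \<sigma> \<tau> N (fst p) (snd p)) \<in> measurable (coin_flips \<Otimes>\<^sub>M coin_flips) (count_space UNIV)"
proof (induction N)
  case (Suc N)
  let ?M = "coin_flips \<Otimes>\<^sub>M coin_flips"
  have skip: "(\<lambda>p. (skip 12 (fst p), skip 12 (snd p))) \<in> measurable ?M ?M" by measurable
  have rest: "(\<lambda>p. bound \<sigma> \<tau> N (skip 12 (fst p)) (skip 12 (snd p))) \<in> measurable ?M (count_space UNIV)"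
    using measurable_compose[OF skip Suc] by simp
  have "(\<lambda>p. let xs = map ((*) \<sigma>) (word (number 12 (fst p))); ys = map ((*) \<tau>) (word k')
      in hit 2 xs ys + (if meets 2 xs ys then 0 else bound \<sigma> \<tau> N (skip 12 (fst p)) (skip 12 (snd p))))
      \<in> measurable ?M (count_space UNIV)" for k'
    by (rule measurable_compose_countable'[where I = UNIV and g = "\<lambda>p. number 12 (fst p)"])
      (auto simp: Let_def intro: measurable_compose[OF rest])
  then show ?case
    unfolding bound.simps
    by (rule measurable_compose_countable'[where I = UNIV and g = "\<lambda>p. number 12 (snd p)"]) auto
qed simp

text \<open>The renewal equation: after a failed phase the unread bits are fresh, so the expected
  remainder is \<open>J N\<close> whatever was read. Iterated integrals let the block lemma treat
  one robot at a time.\<close>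

lemma nn_integral_bound_Suc:
  fixes \<sigma> \<tau> N
  defines "h \<equiv> \<lambda>k k'. hit 2 (map ((*) \<sigma>) (word k)) (map ((*) \<tau>) (word k'))"
    and "m \<equiv> \<lambda>k k'. meets 2 (map ((*) \<sigma>) (word k)) (map ((*) \<tau>) (word k'))"
    and "J \<equiv> \<lambda>N. \<integral>\<^sup>+\<omega>. \<integral>\<^sup>+\<omega>'. ennreal (real (bound \<sigma> \<tau> N \<omega> \<omega>')) \<partial>coin_flips \<partial>coin_flips"
  shows "J (Suc N) = (\<Sum>k<2^12. \<Sum>k'<2^12. ennreal (real (h k k')) + (if m k k' then 0 else J N)) / 2^12 / 2^12"
proof -
  define F where "F k k' \<omega> \<omega>' = ennreal (real (h k k' + (if m k k' then 0 else bound \<sigma> \<tau> N \<omega> \<omega>')))"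
    for k k' \<omega> \<omega>'
  have F2: "(\<lambda>p. F k k' (fst p) (snd p)) \<in> borel_measurable (coin_flips \<Otimes>\<^sub>M coin_flips)" for k k'
    unfolding F_def using measurable_compose[OF measurable_bound] by (cases "m k k'") (auto intro: measurable_compose[OF measurable_bound])
  have F1: "F k k' \<omega> \<in> borel_measurable coin_flips" for k k' \<omega>
    using measurable_compose[OF measurable_Pair1' F2, of \<omega>] by (simp add: coin_flips_def space_PiM PiE_iff)
  have F3: "(\<lambda>\<omega>. \<integral>\<^sup>+\<omega>'. F k k' \<omega> \<omega>' \<partial>coin_flips) \<in> borel_measurable coin_flips" for k k'
    using coin_pair.M1.borel_measurable_nn_integral_fst[OF F2] by simp
  have "J (Suc N) = (\<integral>\<^sup>+\<omega>. \<integral>\<^sup>+\<omega>'. F (number 12 \<omega>) (number 12 \<omega>') (skip 12 \<omega>) (skip 12 \<omega>') \<partial>coin_flips \<partial>coin_flips)"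
    unfolding J_def F_def h_def m_def by (simp add: Let_def)
  also have "\<dots> = (\<integral>\<^sup>+\<omega>. (\<Sum>k'<2^12. \<integral>\<^sup>+\<omega>'. F (number 12 \<omega>) k' (skip 12 \<omega>) \<omega>' \<partial>coin_flips) / 2^12 \<partial>coin_flips)"
    by (intro nn_integral_cong nn_integral_block F1)
  also have "\<dots> = (\<Sum>k<2^12. \<integral>\<^sup>+\<omega>. (\<Sum>k'<2^12. \<integral>\<^sup>+\<omega>'. F k k' \<omega> \<omega>' \<partial>coin_flips) / 2^12 \<partial>coin_flips) / 2^12"
    by (rule nn_integral_block[where F = "\<lambda>k \<omega>. (\<Sum>k'<2^12. \<integral>\<^sup>+\<omega>'. F k k' \<omega> \<omega>' \<partial>coin_flips) / 2^12"])
      (intro borel_measurable_divide_ennreal borel_measurable_sum F3 borel_measurable_const)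
  also have "\<dots> = (\<Sum>k<2^12. (\<Sum>k'<2^12. \<integral>\<^sup>+\<omega>. \<integral>\<^sup>+\<omega>'. F k k' \<omega> \<omega>' \<partial>coin_flips \<partial>coin_flips) / 2^12) / 2^12"
  proof -
    have "(\<integral>\<^sup>+\<omega>. (\<Sum>k'<2^12. \<integral>\<^sup>+\<omega>'. F k k' \<omega> \<omega>' \<partial>coin_flips) / 2^12 \<partial>coin_flips) =
        (\<Sum>k'<2^12. \<integral>\<^sup>+\<omega>. \<integral>\<^sup>+\<omega>'. F k k' \<omega> \<omega>' \<partial>coin_flips \<partial>coin_flips) / 2^12" for k
      by (subst nn_integral_divide, intro borel_measurable_sum F3, subst nn_integral_sum)
        (simp_all only: F3)
    then show ?thesis by simp
  qed
  also have "\<dots> = (\<Sum>k<2^12. \<Sum>k'<2^12. \<integral>\<^sup>+\<omega>. \<integral>\<^sup>+\<omega>'. F k k' \<omega> \<omega>' \<partial>coin_flips \<partial>coin_flips) / 2^12 / 2^12"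
    by (simp only: divide_ennreal_def sum_distrib_right)
  finally have "J (Suc N) = \<dots>" .
  moreover have "(\<integral>\<^sup>+\<omega>. \<integral>\<^sup>+\<omega>'. F k k' \<omega> \<omega>' \<partial>coin_flips \<partial>coin_flips) =
      ennreal (real (h k k')) + (if m k k' then 0 else J N)" for k k'
  proof -
    have "(\<integral>\<^sup>+\<omega>'. F k k' \<omega> \<omega>' \<partial>coin_flips) = ennreal (real (h k k')) +
        (if m k k' then 0 else \<integral>\<^sup>+\<omega>'. ennreal (real (bound \<sigma> \<tau> N \<omega> \<omega>')) \<partial>coin_flips)" for \<omega>
      by (simp add: F_def nn_integral_const_add coin_pair.M1.prob_space_axioms coin_pair.M1.emeasure_space_1)
    then show ?thesis
      by (simp add: J_def nn_integral_const_add coin_pair.M1.prob_space_axioms coin_pair.M1.emeasure_space_1)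
  qed
  ultimately show ?thesis by (simp only:)
qed

text \<open>The constant is a supersolution of the renewal equation,
  \<open>C + p * 4.2574 \<le> 4.2574\<close>, so the induction starting from 0 never exceeds
  it.\<close>

lemma nn_integral_bound:
  assumes "\<bar>\<sigma>\<bar> = 1" "\<bar>\<tau>\<bar> = 1"
  shows "(\<integral>\<^sup>+\<omega>. \<integral>\<^sup>+\<omega>'. ennreal (real (bound \<sigma> \<tau> N \<omega> \<omega>')) \<partial>coin_flips \<partial>coin_flips) \<le> ennreal 4.2574"
proof (induction N)
  case (Suc N)
  let ?h = "\<lambda>k k'. hit 2 (map ((*) \<sigma>) (word k)) (map ((*) \<tau>) (word k'))"
  let ?m = "\<lambda>k k'. meets 2 (map ((*) \<sigma>) (word k)) (map ((*) \<tau>) (word k'))"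
  let ?J = "\<integral>\<^sup>+\<omega>. \<integral>\<^sup>+\<omega>'. ennreal (real (bound \<sigma> \<tau> N \<omega> \<omega>')) \<partial>coin_flips \<partial>coin_flips"
  have nonneg: "0 \<le> real (?h k k') + real (of_bool (\<not> ?m k k')) * 4.2574" for k k'
    by simp
  have "(\<Sum>k<2^12. \<Sum>k'<2^12. ennreal (real (?h k k')) + (if ?m k k' then 0 else ?J)) \<le>
      (\<Sum>k<2^12. \<Sum>k'<2^12. ennreal (real (?h k k') + real (of_bool (\<not> ?m k k')) * 4.2574))"
    using Suc.IH by (intro sum_mono) (auto intro!: add_left_mono simp: ennreal_plus)
  also have "\<dots> = ennreal (\<Sum>k<2^12. \<Sum>k'<2^12. real (?h k k') + real (of_bool (\<not> ?m k k')) * 4.2574)"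
    by (simp only: sum_ennreal sum_nonneg nonneg)
  also have "(\<Sum>k<2^12. \<Sum>k'<2^12. real (?h k k') + real (of_bool (\<not> ?m k k')) * 4.2574) =
      real (\<Sum>k<2^12. \<Sum>k'<2^12. ?h k k') + real (\<Sum>k<2^12. \<Sum>k'<2^12. of_bool (\<not> ?m k k')) * 4.2574"
    by (simp only: of_nat_sum sum.distrib sum_distrib_right)
  \<comment> \<open>Numerically this is
    \<open>71315950 + 25924 * 4.2574 \<le> 4.2574 * 2^24\<close>.\<close>
  also have "\<dots> \<le> 4.2574 * 2^12 * 2^12"
    unfolding sum_hit[OF assms] sum_not_meets[OF assms]
    by (simp add: weight_table hits_table misses_table)
  finally have "(\<Sum>k<2^12. \<Sum>k'<2^12. ennreal (real (?h k k')) + (if ?m k k' then 0 else ?J)) / 2^12 / 2^12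
      \<le> ennreal (4.2574 * 2^12 * 2^12) / 2^12 / 2^12"
    by (intro divide_right_mono_ennreal) (simp add: ennreal_leI)
  also have "\<dots> = ennreal 4.2574"
    by (simp add: ennreal_divide_numeral)
  finally show ?case
    unfolding nn_integral_bound_Suc .
qed simp

subsection \<open>The algorithm\<close>

definition walk :: "real \<Rightarrow> algorithm" where
  "walk \<rho> \<omega> = polyline (\<lambda>k. chain \<rho> (pos \<omega> k))"

lemma SRD_algorithm_walk:
  assumes "\<rho> > 1"
  shows "SRD_algorithm \<rho> (walk \<rho>)"
  unfolding SRD_algorithm_def
proof (intro conjI allI impI)
  fix \<omega>
  have "walk \<rho> \<omega> (real 0) = of_real \<rho>"
    unfolding walk_def polyline_of_nat by (simp add: pos_def chain_def)
  then show "walk \<rho> \<omega> 0 = of_real \<rho>" by simp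
  show "1-lipschitz_on {0..} (walk \<rho> \<omega>)"
    unfolding walk_def
  proof (rule lipschitz_polyline)
    fix k
    have "step \<omega> k = 1 \<or> step \<omega> k = - 1" using abs_step[of \<omega> k] by linarith
    then show "dist (chain \<rho> (pos \<omega> (Suc k))) (chain \<rho> (pos \<omega> k)) \<le> 1"
      using dist_chain_Suc[OF assms, of "pos \<omega> k"] dist_chain_Suc[OF assms, of "pos \<omega> k - 1"]
      by (auto simp: pos_def dist_commute)
  qed
next
  fix t :: real
  have [measurable]: "(\<lambda>\<omega>. step \<omega> j) \<in> measurable coin_flips (count_space UNIV)" for j
    unfolding step_def
    by (rule measurable_compose[OF measurable_compose[OF measurable_skip measurable_number]]) simp
  have [measurable]: "(\<lambda>\<omega>. pos \<omega> k) \<in> measurable coin_flips (count_space UNIV)" for k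
    unfolding pos_def by (induction k) simp_all
  have [measurable]: "(\<lambda>\<omega>. chain \<rho> (pos \<omega> k)) \<in> borel_measurable coin_flips" for k
    by (rule measurable_compose[of "\<lambda>\<omega>. pos \<omega> k" _ "count_space UNIV"]) simp_all
  show "(\<lambda>\<omega>. walk \<rho> \<omega> t) \<in> borel_measurable coin_flips"
    unfolding walk_def polyline_def by measurable
qed

lemma competitive_ratio_walk:
  assumes "\<rho> > 1"
  shows "competitive_ratio \<rho> (walk \<rho>) \<le> ennreal 4.2574"
  unfolding competitive_ratio_def
proof (rule SUP_least)
  fix I assume "I \<in> SRD_instances \<rho>"
  then obtain U V where UV: "I = (U, V)" "(U, V) \<in> SRD_instances \<rho>" by (cases I) auto
  obtain \<sigma> \<tau> :: int where signs: "\<bar>\<sigma>\<bar> = 1" "\<bar>\<tau>\<bar> = 1"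
    and meet: "\<And>m m'. \<sigma> * m - \<tau> * m' = 2 \<Longrightarrow> U (chain \<rho> m) = V (chain \<rho> m')"
    using rendezvous_on_chain[OF UV(2) assms] by blast
  let ?T = "\<lambda>\<omega> \<omega>'. rendezvous_time (\<lambda>t. U (walk \<rho> \<omega> t)) (\<lambda>t. V (walk \<rho> \<omega>' t))"
  \<comment> \<open>The right-hand side is a measurable majorant, accessible to monotone
    convergence. If no truncation yields a meeting it is infinite, so the inequality holds
    trivially.\<close>
  have T: "?T \<omega> \<omega>' \<le> (SUP N. ennreal (real (bound \<sigma> \<tau> N \<omega> \<omega>')))" for \<omega> \<omega>'
  proof (cases "\<exists>N. \<exists>k\<le>bound \<sigma> \<tau> N \<omega> \<omega>'. \<sigma> * pos \<omega> k - \<tau> * pos \<omega>' k = 2")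
    case True
    then obtain N k where k: "k \<le> bound \<sigma> \<tau> N \<omega> \<omega>'" "\<sigma> * pos \<omega> k - \<tau> * pos \<omega>' k = 2" by blast
    have "U (walk \<rho> \<omega> (real k)) = V (walk \<rho> \<omega>' (real k))"
      unfolding walk_def polyline_of_nat using k(2) by (rule meet)
    then have "?T \<omega> \<omega>' \<le> ennreal (real k)"
      unfolding rendezvous_time_def by (intro INF_lower) simp
    also have "\<dots> \<le> ennreal (real (bound \<sigma> \<tau> N \<omega> \<omega>'))"
      using k(1) by (intro ennreal_leI) simp
    finally show ?thesis by (rule order.trans) (rule SUP_upper, simp)
  next
    case False
    then have "N \<le> bound \<sigma> \<tau> N \<omega> \<omega>'" for N
      using meeting_or_large[OF signs, of N \<omega> \<omega>'] by blast
    then have "(SUP N. ennreal (real N)) \<le> (SUP N. ennreal (real (bound \<sigma> \<tau> N \<omega> \<omega>')))"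
      by (intro SUP_mono') (simp add: ennreal_leI)
    moreover have "(SUP N. ennreal (real N)) = \<top>"
      using ennreal_SUP_of_nat_eq_top by (simp only: ennreal_of_nat_eq_real_of_nat)
    ultimately show ?thesis
      by (metis order.trans top_greatest)
  qed
  have meas: "(\<lambda>p. ennreal (real (bound \<sigma> \<tau> N (fst p) (snd p)))) \<in> borel_measurable (coin_flips \<Otimes>\<^sub>M coin_flips)" for N
    by (rule measurable_compose[OF measurable_bound]) simp
  have "expected_rendezvous_time (walk \<rho>) I = (\<integral>\<^sup>+p. ?T (fst p) (snd p) \<partial>(coin_flips \<Otimes>\<^sub>M coin_flips))"
    unfolding expected_rendezvous_time_def UV(1) case_prod_beta fst_conv snd_conv ..
  also have "\<dots> \<le> (\<integral>\<^sup>+p. (SUP N. ennreal (real (bound \<sigma> \<tau> N (fst p) (snd p)))) \<partial>(coin_flips \<Otimes>\<^sub>M coin_flips))"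
    by (intro nn_integral_mono T)
  also have "\<dots> = (SUP N. \<integral>\<^sup>+p. ennreal (real (bound \<sigma> \<tau> N (fst p) (snd p))) \<partial>(coin_flips \<Otimes>\<^sub>M coin_flips))"
    by (intro nn_integral_monotone_convergence_SUP meas incseq_SucI)
      (simp add: le_fun_def ennreal_leI bound_mono del: bound.simps)
  also have "\<dots> \<le> ennreal 4.2574"
  proof (rule SUP_least)
    fix N
    show "(\<integral>\<^sup>+p. ennreal (real (bound \<sigma> \<tau> N (fst p) (snd p))) \<partial>(coin_flips \<Otimes>\<^sub>M coin_flips)) \<le> ennreal 4.2574"
      using nn_integral_bound[OF signs, of N] coin_pair.M1.nn_integral_fst[OF meas, of N] by simp
  qed
  finally show "expected_rendezvous_time (walk \<rho>) I \<le> ennreal 4.2574" .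
qed

theorem theorem1:
  shows "\<exists>A :: real \<Rightarrow> algorithm.
           (\<forall>\<rho>>sqrt 2. SRD_algorithm \<rho> (A \<rho>) \<and> competitive 4.2574 \<rho> (A \<rho>)) \<and>
           effective 0 A"
proof -
  have "\<exists>Y. SRD_algorithm \<rho> Y \<and> competitive 4.2574 \<rho> Y" if "\<rho> > sqrt 2" for \<rho>
  proof (rule competitive_delay)
    show "\<rho> > 1" using that by (rule less_trans[rotated]) simp
    then show "SRD_algorithm \<rho> (walk \<rho>)" "competitive_ratio \<rho> (walk \<rho>) \<le> ennreal 4.2574"
      by (rule SRD_algorithm_walk, rule competitive_ratio_walk)
  qed
  then obtain A where "\<And>\<rho>. \<rho> > sqrt 2 \<Longrightarrow> SRD_algorithm \<rho> (A \<rho>) \<and> competitive 4.2574 \<rho> (A \<rho>)"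
    by metis
  \<comment> \<open>Equality with 4.2574 also supplies the lower bound 4.25 that
    \<open>effective 0\<close> asks for.\<close>
  then show ?thesis
    by (intro exI[of _ A]) (auto simp: effective_def competitive_def intro!: ennreal_leI)
qed

end
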